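(* Let $X$ be a finite-dimensional real normed space. If $X$ is not Euclidean, then there exist a linear map $P:X\to X$ and an $\alpha\ge 0$ such that $\tilde{P}_\alpha$ is not $(\mathsf{C}_X,\mathsf{C}_X)$-entanglement breaking and such that $$\tilde{P}_\alpha^{\otimes k}\left(\mathsf{C}_X^{\hat{\otimes}k}\right)\subseteq\mathsf{C}_X^{\otimes_{\min}k}\quad\text{and}\quad\tilde{P}_\alpha^{\otimes k}\left(\mathsf{C}_X^{\otimes_{\max}k}\right)\subseteq\mathsf{C}_X^{\check{\otimes}k}$$ for any $k\in\mathbb{N}$.
   Context: A convex cone $\mathsf{C}\subset V$ in a finite-dimensional real vector space is proper if it is closed, $\mathsf{C}-\mathsf{C}=V$ and $\mathsf{C}\cap(-\mathsf{C})=\{0\}$; its dual cone is $\mathsf{C}^*=\{\phi\in V^*:\phi(x)\ge0\ \forall x\in\mathsf{C}\}$. Let $\mathsf{C}_1\otimes_{\min}\mathsf{C}_2=\mathrm{conv}\{x\otimes y: x\in\mathsf{C}_1,y\in\mathsf{C}_2\}$, $\mathsf{C}_1\otimes_{\max}\mathsf{C}_2=(\mathsf{C}_1^*\otimes_{\min}\mathsf{C}_2^* )^*$, with iterated powers $\mathsf{C}^{\otimes_{\min}k}$, $\mathsf{C}^{\otimes_{\max}k}$. A linear map $Q:V_1\to V_2$ is $(\mathsf{C}_1,\mathsf{C}_2)$-entanglement breaking if $Q=\sum_i x_i\phi_i$ is a finite sum with $x_i\in\mathsf{C}_2$, $\phi_i\in\mathsf{C}_1^*$. A normed space is Euclidean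 if its norm comes from an inner product. For a finite-dimensional normed space $X$ put $\mathsf{C}_X=\{(t,x)\in\mathbb{R}\oplus X: t\ge\|x\|_X\}$. For $\alpha\in\mathbb{R}$ and linear $P:X\to X$, $\tilde{P}_\alpha=\alpha\oplus P:\mathbb{R}\oplus X\to\mathbb{R}\oplus X$ is the map $(t,x)\mapsto(\alpha t,P(x))$. On $X^{\otimes k}$ the injective norm is $\|z\|_{\varepsilon_k(X)}=\sup\{|(\lambda_1\otimes\cdots\otimes\lambda_k)(z)|:\lambda_1,\dots,\lambda_k\in B_{X^*}\}$ ($B_{X^*}$ the unit ball of $X^*$) and the projective norm is $\|z\|_{\pi_k(X)}=\inf\{\sum_{i=1}^n\|x_i^{(1)}\|_X\cdots\|x_i^{(k)}\|_X: n\in\mathbb{N},\ z=\sum_{i=1}^n x_i^{(1)}\otimes\cdots\otimes x_i^{(k)}\}$. Let $e_0=(1,0)\in\mathbb{R}\oplus X$, and view $X\subset\mathbb{R}\oplus X$ via $x\mapsto(0,x)$. Let $X_k=\mathrm{span}(\{e_0^{\otimes k}\}\cup X^{\otimes k})\subset(\mathbb{R}\oplus X)^{\otimes k}$, and let $\Pi_{X_k}$ be the orthogonal projection of $(\mathbb{R}\oplus X)^{\otimes k}$ onto $X_k$, i.e. the projection which is the identity on $e_0^{\otimes k}$ and $X^{\otimes k}$ and vanishes on tensor products of $k$ factors, each either $e_0$ or in $X$, in which both kinds of factor occur. Identifying $te_0^{\otimes k}+z$ with $(t,z)$, regard $\mathsf{C}_{\varepsilon_k(X)}=\{te_0^{\otimes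 k}+z: z\in X^{\otimes k},\ t\ge\|z\|_{\varepsilon_k(X)}\}$ and $\mathsf{C}_{\pi_k(X)}=\{te_0^{\otimes k}+z: z\in X^{\otimes k},\ t\ge\|z\|_{\pi_k(X)}\}$ as subsets of $X_k$. Define $$\mathsf{C}_X^{\check{\otimes}k}=\{z\in\mathsf{C}_X^{\otimes_{\max}k}:\Pi_{X_k}(z)\in\mathsf{C}_{\pi_k(X)}\},\qquad\mathsf{C}_X^{\hat{\otimes}k}=\mathsf{C}_X^{\otimes_{\min}k}\vee\mathsf{C}_{\varepsilon_k(X)},$$ where $\vee$ denotes the convex hull of the union (for these cones, the sum of the two cones). *)

theory Defs
  imports "HOL-Analysis.Analysis"
begin

section \<open>Tensor powers\<close>

text \<open>
  A tensor over a finite-dimensional space \<open>V\<close> is identified with the multilinear form that it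
  induces on the dual of \<open>V\<close>, the elementary tensor \<open>x\<^sub>1 \<otimes> \<dots> \<otimes> x\<^sub>k\<close> being
  \<open>(\<phi>\<^sub>1, \<dots>, \<phi>\<^sub>k) \<mapsto> \<phi>\<^sub>1 x\<^sub>1 \<cdots> \<phi>\<^sub>k x\<^sub>k\<close>; evaluating \<open>z\<close> at \<open>[\<phi>\<^sub>1, \<dots>, \<phi>\<^sub>k]\<close> is then applying the functional
  \<open>\<phi>\<^sub>1 \<otimes> \<dots> \<otimes> \<phi>\<^sub>k\<close> to \<open>z\<close>. The type below holds arbitrary functions on lists of functionals, so that
  all degrees live in one real vector space; the \<open>k\<close>-th tensor power of \<open>V\<close> is the subspace
  \<open>tens_pow k\<close>. As all spaces in use are finite-dimensional, bounded linear functionals (and maps)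
  are the same as linear ones.
\<close>

typedef (overloaded) 'a tens = "UNIV :: (('a::real_normed_vector \<Rightarrow>\<^sub>L real) list \<Rightarrow> real) set"
  morphisms tens_app Tens
  by simp

setup_lifting type_definition_tens

instantiation tens :: (real_normed_vector) real_vector
begin

lift_definition zero_tens :: "'a tens" is "\<lambda>\<phi>s. 0" .
lift_definition plus_tens :: "'a tens \<Rightarrow> 'a tens \<Rightarrow> 'a tens" is "\<lambda>z w \<phi>s. z \<phi>s + w \<phi>s" .
lift_definition minus_tens :: "'a tens \<Rightarrow> 'a tens \<Rightarrow> 'a tens" is "\<lambda>z w \<phi>s. z \<phi>s - w \<phi>s" .
lift_definition uminus_tens :: "'a tens \<Rightarrow> 'a tens" is "\<lambda>z \<phi>s. - z \<phi>s" .
lift_definition scaleR_tens :: "real \<Rightarrow> 'a tens \<Rightarrow> 'a tens" is "\<lambda>c z \<phi>s. c * z \<phi>s" .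

instance
  by standard (transfer; simp add: fun_eq_iff algebra_simps)+

end

lift_definition elem_tens :: "'a::real_normed_vector list \<Rightarrow> 'a tens" is
  "\<lambda>xs \<phi>s. if length \<phi>s = length xs
    then (\<Prod>i<length xs. blinfun_apply (\<phi>s ! i) (xs ! i)) else 0" .

definition tens_pow :: "nat \<Rightarrow> 'a::real_normed_vector tens set" where
  "tens_pow k = span (elem_tens ` {xs. length xs = k})"

text \<open>\<open>f \<otimes> \<dots> \<otimes> f\<close>; see \<open>tens_map_elem_tens\<close> below.\<close>

lift_definition tens_map ::
  "('a::real_normed_vector \<Rightarrow>\<^sub>L 'b::real_normed_vector) \<Rightarrow> 'a tens \<Rightarrow> 'b tens" is
  "\<lambda>f z \<psi>s. z (map (\<lambda>\<psi>. \<psi> o\<^sub>L f) \<psi>s)" .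


section \<open>Cones\<close>

definition dual_cone :: "'a::real_normed_vector set \<Rightarrow> ('a \<Rightarrow>\<^sub>L real) set" where
  "dual_cone C = {\<phi>. \<forall>x\<in>C. 0 \<le> blinfun_apply \<phi> x}"

definition min_pow :: "nat \<Rightarrow> 'a::real_normed_vector set \<Rightarrow> 'a tens set" where
  "min_pow k C = convex hull (elem_tens ` {xs. length xs = k \<and> set xs \<subseteq> C})"

text \<open>The dual of the \<open>k\<close>-fold minimal tensor power of the dual cone.\<close>

definition max_pow :: "nat \<Rightarrow> 'a::real_normed_vector set \<Rightarrow> 'a tens set" where
  "max_pow k C =
    {z \<in> tens_pow k. \<forall>\<phi>s. length \<phi>s = k \<and> set \<phi>s \<subseteq> dual_cone C \<longrightarrow> 0 \<le> tens_app z \<phi>s}"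

definition entanglement_breaking ::
  "'a::real_normed_vector set \<Rightarrow> 'b::real_normed_vector set \<Rightarrow> ('a \<Rightarrow>\<^sub>L 'b) \<Rightarrow> bool" where
  "entanglement_breaking C\<^sub>1 C\<^sub>2 Q \<longleftrightarrow>
    (\<exists>(n::nat) x \<phi>. (\<forall>i<n. x i \<in> C\<^sub>2 \<and> \<phi> i \<in> dual_cone C\<^sub>1) \<and>
      (\<forall>v. blinfun_apply Q v = (\<Sum>i<n. blinfun_apply (\<phi> i) v *\<^sub>R x i)))"


section \<open>Norms\<close>

definition is_inner_product :: "('a::real_vector \<Rightarrow> 'a \<Rightarrow> real) \<Rightarrow> bool" where
  "is_inner_product B \<longleftrightarrow>
    bilinear B \<and> (\<forall>x y. B x y = B y x) \<and> (\<forall>x. x \<noteq> 0 \<longrightarrow> 0 < B x x)"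

definition euclidean_norm :: "('a::real_vector \<Rightarrow> real) \<Rightarrow> bool" where
  "euclidean_norm N \<longleftrightarrow> (\<exists>B. is_inner_product B \<and> (\<forall>x. N x = sqrt (B x x)))"

definition inj_norm :: "nat \<Rightarrow> 'a::real_normed_vector tens \<Rightarrow> real" where
  "inj_norm k z = Sup {\<bar>tens_app z \<phi>s\<bar> | \<phi>s. length \<phi>s = k \<and> (\<forall>\<phi>\<in>set \<phi>s. norm \<phi> \<le> 1)}"

definition proj_norm :: "nat \<Rightarrow> 'a::real_normed_vector tens \<Rightarrow> real" where
  "proj_norm k z = Inf {(\<Sum>xs\<leftarrow>xss. \<Prod>x\<leftarrow>xs. norm x) | xss.
    (\<forall>xs\<in>set xss. length xs = k) \<and> z = (\<Sum>xs\<leftarrow>xss. elem_tens xs)}"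


section \<open>The space \<open>\<real> \<oplus> X\<close>\<close>

text \<open>
  \<open>\<real> \<oplus> X\<close> is the product type. Only its vector space structure matters: its library norm enters
  solely through the boundedness of linear maps, which is automatic.
\<close>

definition norm_cone :: "(real \<times> 'a::real_normed_vector) set" where
  "norm_cone = {(t, x). norm x \<le> t}"

definition scal_oplus ::
  "real \<Rightarrow> ('a::real_normed_vector \<Rightarrow>\<^sub>L 'a) \<Rightarrow> (real \<times> 'a) \<Rightarrow>\<^sub>L (real \<times> 'a)" where
  "scal_oplus \<alpha> P = Blinfun (\<lambda>(t, x). (\<alpha> * t, blinfun_apply P x))"

definition incl_X :: "'a::real_normed_vector \<Rightarrow>\<^sub>L (real \<times> 'a)" where
  "incl_X = Blinfun (\<lambda>x. (0, x))"

definition e\<^sub>0 :: "real \<times> 'a::real_normed_vector" where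
  "e\<^sub>0 = (1, 0)"

definition e0_pow :: "nat \<Rightarrow> (real \<times> 'a::real_normed_vector) tens" where
  "e0_pow k = elem_tens (replicate k e\<^sub>0)"

definition cone_inj :: "nat \<Rightarrow> (real \<times> 'a::real_normed_vector) tens set" where
  "cone_inj k = {t *\<^sub>R e0_pow k + tens_map incl_X z | t z. z \<in> tens_pow k \<and> inj_norm k z \<le> t}"

definition cone_proj :: "nat \<Rightarrow> (real \<times> 'a::real_normed_vector) tens set" where
  "cone_proj k = {t *\<^sub>R e0_pow k + tens_map incl_X z | t z. z \<in> tens_pow k \<and> proj_norm k z \<le> t}"

text \<open>
  The projection onto \<open>X\<^sub>k\<close> for \<open>k \<ge> 1\<close>. The functional \<open>fst \<otimes> \<dots> \<otimes> fst\<close> extracts the coefficient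
  of \<open>e\<^sub>0 \<otimes> \<dots> \<otimes> e\<^sub>0\<close>, and \<open>incl_X o\<^sub>L snd_blinfun\<close> is \<open>(t, x) \<mapsto> (0, x)\<close>. The lemmas
  \<open>proj_Xk_e0_pow\<close>, \<open>proj_Xk_incl\<close> and \<open>proj_Xk_mixed\<close> below give its defining properties.
\<close>

definition proj_Xk ::
  "nat \<Rightarrow> (real \<times> 'a::real_normed_vector) tens \<Rightarrow> (real \<times> 'a) tens" where
  "proj_Xk k z = tens_app z (replicate k fst_blinfun) *\<^sub>R e0_pow k
    + tens_map (incl_X o\<^sub>L snd_blinfun) z"

definition check_pow :: "nat \<Rightarrow> (real \<times> 'a::real_normed_vector) tens set" where
  "check_pow k = {z \<in> max_pow k norm_cone. proj_Xk k z \<in> cone_proj k}"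

definition hat_pow :: "nat \<Rightarrow> (real \<times> 'a::real_normed_vector) tens set" where
  "hat_pow k = convex hull (min_pow k norm_cone \<union> cone_inj k)"


section \<open>Basic properties of the definitions\<close>

lemma tens_eqI: "(\<And>\<phi>s. tens_app z \<phi>s = tens_app w \<phi>s) \<Longrightarrow> z = w"
  by (metis tens_app_inject ext)

lemma tens_app_simps [simp]:
  "tens_app 0 \<phi>s = 0"
  "tens_app (z + w) \<phi>s = tens_app z \<phi>s + tens_app w \<phi>s"
  "tens_app (c *\<^sub>R z) \<phi>s = c * tens_app z \<phi>s"
  by (simp_all add: zero_tens.rep_eq plus_tens.rep_eq scaleR_tens.rep_eq)

lemma scal_oplus_apply: "blinfun_apply (scal_oplus \<alpha> P) (t, x) = (\<alpha> * t, blinfun_apply P x)"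
proof -
  have "bounded_linear (\<lambda>p :: real \<times> 'a. (\<alpha> * fst p, blinfun_apply P (snd p)))"
    by (intro bounded_linear_Pair bounded_linear_const_mult bounded_linear_fst
        blinfun.bounded_linear_right bounded_linear_compose[OF _ bounded_linear_snd])
  then show ?thesis
    by (simp add: scal_oplus_def case_prod_unfold bounded_linear_Blinfun_apply)
qed

lemma incl_X_apply: "blinfun_apply incl_X x = (0, x)"
  unfolding incl_X_def
  by (simp add: bounded_linear_Blinfun_apply bounded_linear_Pair bounded_linear_zero
      bounded_linear_ident)

lemma tens_map_elem_tens: "tens_map f (elem_tens xs) = elem_tens (map (blinfun_apply f) xs)"
  by (rule tens_eqI) (auto simp: tens_map.rep_eq elem_tens.rep_eq)

lemma linear_tens_map: "linear (tens_map f)"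
  by (rule linearI; rule tens_eqI; simp add: tens_map.rep_eq)

lemma linear_proj_Xk: "linear (proj_Xk k)"
  by (rule linearI)
     (simp_all add: proj_Xk_def linear_add[OF linear_tens_map] linear_scale[OF linear_tens_map]
        algebra_simps)

lemma elem_tens_zero: "0 \<in> set xs \<Longrightarrow> elem_tens xs = 0"
  by (rule tens_eqI, auto simp: elem_tens.rep_eq in_set_conv_nth intro!: prod_zero)
     (metis blinfun.zero_right lessThan_iff)

lemma proj_Xk_e0_pow: "k \<ge> 1 \<Longrightarrow> proj_Xk k (e0_pow k) = e0_pow k"
proof -
  assume k: "k \<ge> 1"
  have "tens_map (incl_X o\<^sub>L snd_blinfun) (e0_pow k :: (real \<times> 'a) tens) = 0"
    unfolding e0_pow_def tens_map_elem_tens using k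
    by (intro elem_tens_zero) (auto simp: e\<^sub>0_def incl_X_apply snd_blinfun.rep_eq zero_prod_def)
  moreover have "tens_app (e0_pow k :: (real \<times> 'a) tens) (replicate k fst_blinfun) = 1"
    by (simp add: e0_pow_def elem_tens.rep_eq fst_blinfun.rep_eq e\<^sub>0_def)
  ultimately show ?thesis by (simp add: proj_Xk_def)
qed

lemma proj_Xk_incl:
  assumes "k \<ge> 1" "z \<in> tens_pow k"
  shows "proj_Xk k (tens_map incl_X z) = tens_map incl_X z"
proof (rule linear_eq_on[where f = "\<lambda>z. proj_Xk k (tens_map incl_X z)"])
  show "linear (\<lambda>z. proj_Xk k (tens_map incl_X z))"
    using linear_compose[OF linear_tens_map linear_proj_Xk] by (simp add: o_def)
  show "linear (tens_map incl_X)" by (rule linear_tens_map)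
  show "z \<in> span (elem_tens ` {xs. length xs = k})"
    using assms(2) by (simp add: tens_pow_def)
  fix b :: "'a tens"
  assume "b \<in> elem_tens ` {xs. length xs = k}"
  then obtain xs :: "'a list" where xs: "b = elem_tens xs" "length xs = k" by auto
  have "tens_app (elem_tens (map (blinfun_apply incl_X) xs)) (replicate k fst_blinfun) = 0"
    using xs(2) assms(1) by (auto simp: elem_tens.rep_eq fst_blinfun.rep_eq incl_X_apply)
  moreover have "map (blinfun_apply (incl_X o\<^sub>L snd_blinfun)) (map (blinfun_apply incl_X) xs)
      = map (blinfun_apply incl_X) xs"
    by (auto simp: incl_X_apply snd_blinfun.rep_eq)
  ultimately show "proj_Xk k (tens_map incl_X b) = tens_map incl_X b"
    by (simp only: xs(1) proj_Xk_def tens_map_elem_tens scaleR_zero_left add_0_left)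
qed

lemma proj_Xk_mixed:
  assumes "length ps = k" "e\<^sub>0 \<in> set ps" "(0, x) \<in> set ps"
  shows "proj_Xk k (elem_tens ps) = 0"
proof -
  have "tens_app (elem_tens ps) (replicate k fst_blinfun) = 0"
    using assms(1,3)
    by (force simp: elem_tens.rep_eq fst_blinfun.rep_eq in_set_conv_nth intro!: prod_zero)
  moreover have "tens_map (incl_X o\<^sub>L snd_blinfun) (elem_tens ps) = 0"
    unfolding tens_map_elem_tens using assms(2)
    by (intro elem_tens_zero) (force simp: e\<^sub>0_def incl_X_apply snd_blinfun.rep_eq zero_prod_def)
  ultimately show ?thesis by (simp add: proj_Xk_def)
qed

text \<open>
  \<open>tens_cons\<close> is \<open>(x, z) \<mapsto> x \<otimes> z\<close>, and \<open>f (tens_contract \<phi> z)\<close> is \<open>(\<phi> \<otimes> f) (z)\<close>. With these, \<open>min_pow_Suc\<close>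
  and \<open>max_pow_Suc\<close> express the \<open>k\<close>-fold cones as iterated binary tensor products.
\<close>

lift_definition tens_cons :: "'a::real_normed_vector \<Rightarrow> 'a tens \<Rightarrow> 'a tens" is
  "\<lambda>x z \<phi>s. case \<phi>s of [] \<Rightarrow> 0 | \<phi> # \<psi>s \<Rightarrow> blinfun_apply \<phi> x * z \<psi>s" .

lift_definition tens_contract :: "('a::real_normed_vector \<Rightarrow>\<^sub>L real) \<Rightarrow> 'a tens \<Rightarrow> 'a tens" is
  "\<lambda>(\<phi> :: 'a \<Rightarrow>\<^sub>L real) z \<psi>s. z (\<phi> # \<psi>s)" .

lemma linear_tens_cons: "linear (tens_cons x)"
  by (rule linearI; rule tens_eqI; simp add: tens_cons.rep_eq algebra_simps split: list.split)

lemma linear_tens_contract: "linear (tens_contract \<phi>)"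
  by (rule linearI; rule tens_eqI; simp add: tens_contract.rep_eq)

lemma elem_tens_Cons: "elem_tens (x # xs) = tens_cons x (elem_tens xs)"
  by (rule tens_eqI) (auto simp: elem_tens.rep_eq tens_cons.rep_eq prod.lessThan_Suc_shift
      simp del: prod.lessThan_Suc split: list.split)

lemma tens_contract_tens_cons: "tens_contract \<phi> (tens_cons x z) = blinfun_apply \<phi> x *\<^sub>R z"
  by (rule tens_eqI) (simp add: tens_contract.rep_eq tens_cons.rep_eq)

lemma min_pow_1: "convex C \<Longrightarrow> min_pow 1 C = (\<lambda>x. elem_tens [x]) ` C"
proof -
  assume C: "convex C"
  have *: "elem_tens ` {xs. length xs = 1 \<and> set xs \<subseteq> C} = (\<lambda>x. elem_tens [x]) ` C"
    by (auto simp: length_Suc_conv image_def)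
  have "linear (\<lambda>x::'a. elem_tens [x])"
    by (rule linearI; rule tens_eqI; simp add: elem_tens.rep_eq blinfun.add_right blinfun.scaleR_right)
  then show ?thesis
    unfolding min_pow_def * using C by (simp add: convex_linear_image hull_same)
qed

lemma min_pow_Suc:
  "min_pow (Suc k) C = convex hull {tens_cons x z | x z. x \<in> C \<and> z \<in> min_pow k C}"
proof
  show "min_pow (Suc k) C \<subseteq> convex hull {tens_cons x z | x z. x \<in> C \<and> z \<in> min_pow k C}"
    unfolding min_pow_def[of "Suc k"]
  proof (rule hull_mono, safe)
    fix xs :: "'a list"
    assume "length xs = Suc k" "set xs \<subseteq> C"
    then obtain x ys where "xs = x # ys" "x \<in> C" "length ys = k" "set ys \<subseteq> C"
      by (cases xs) auto
    moreover from this have "elem_tens ys \<in> min_pow k C"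
      unfolding min_pow_def by (intro hull_inc) auto
    ultimately show "\<exists>x z. elem_tens xs = tens_cons x z \<and> x \<in> C \<and> z \<in> min_pow k C"
      using elem_tens_Cons by blast
  qed
  show "convex hull {tens_cons x z | x z. x \<in> C \<and> z \<in> min_pow k C} \<subseteq> min_pow (Suc k) C"
  proof (rule hull_minimal, safe)
    fix x z
    assume x: "x \<in> C" and "z \<in> min_pow k C"
    then have "tens_cons x z
        \<in> convex hull (tens_cons x ` elem_tens ` {xs. length xs = k \<and> set xs \<subseteq> C})"
      unfolding min_pow_def by (simp add: convex_hull_linear_image[OF linear_tens_cons, symmetric])
    also have "\<dots> \<subseteq> min_pow (Suc k) C"
      unfolding min_pow_def
    proof (rule hull_mono, safe)
      fix xs :: "'a list"
      assume "set xs \<subseteq> C" "k = length xs"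
      then show "tens_cons x (elem_tens xs)
          \<in> elem_tens ` {ys. length ys = Suc (length xs) \<and> set ys \<subseteq> C}"
        using x by (intro image_eqI[of _ _ "x # xs"]) (auto simp: elem_tens_Cons)
    qed
    finally show "tens_cons x z \<in> min_pow (Suc k) C" .
  qed (simp add: min_pow_def)
qed

lemma tens_contract_tens_pow:
  assumes "z \<in> tens_pow (Suc k)"
  shows "tens_contract \<phi> z \<in> tens_pow k"
proof -
  have "tens_contract \<phi> ` span (elem_tens ` {xs. length xs = Suc k}) \<subseteq> tens_pow k"
    unfolding linear_span_image[OF linear_tens_contract, symmetric]
  proof (rule span_minimal, safe)
    fix xs :: "'a list"
    assume "length xs = Suc k"
    then show "tens_contract \<phi> (elem_tens xs) \<in> tens_pow k"
      unfolding tens_pow_def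
      by (cases xs) (auto simp: elem_tens_Cons tens_contract_tens_cons intro!: span_scale intro: span_base)
  qed (simp add: tens_pow_def)
  then show ?thesis using assms by (auto simp: tens_pow_def)
qed

lemma max_pow_Suc:
  "max_pow (Suc k) C = {z \<in> tens_pow (Suc k). \<forall>\<phi>\<in>dual_cone C.
    \<forall>f. linear f \<and> (\<forall>w\<in>max_pow k C. 0 \<le> f w) \<longrightarrow> 0 \<le> (f (tens_contract \<phi> z) :: real)}"
  (is "_ = ?R")
proof
  have "tens_contract \<phi> z \<in> max_pow k C"
    if "z \<in> max_pow (Suc k) C" "\<phi> \<in> dual_cone C" for z \<phi>
    using that by (simp add: max_pow_def tens_contract_tens_pow tens_contract.rep_eq)
  then show "max_pow (Suc k) C \<subseteq> ?R"
    by (auto simp: max_pow_def)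
  show "?R \<subseteq> max_pow (Suc k) C"
  proof
    fix z
    assume z: "z \<in> ?R"
    have "0 \<le> tens_app z \<phi>s" if \<phi>s: "length \<phi>s = Suc k" "set \<phi>s \<subseteq> dual_cone C" for \<phi>s
    proof -
      obtain \<phi> \<psi>s where *: "\<phi>s = \<phi> # \<psi>s" "length \<psi>s = k" "\<phi> \<in> dual_cone C" "set \<psi>s \<subseteq> dual_cone C"
        using \<phi>s by (cases \<phi>s) auto
      have "linear (\<lambda>w. tens_app w \<psi>s)" by (rule linearI) auto
      moreover have "\<forall>w\<in>max_pow k C. 0 \<le> tens_app w \<psi>s"
        using * by (auto simp: max_pow_def)
      ultimately have "0 \<le> tens_app (tens_contract \<phi> z) \<psi>s"
        using z *(3) by blast
      then show ?thesis by (simp add: *(1) tens_contract.rep_eq)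
    qed
    then show "z \<in> max_pow (Suc k) C" using z by (auto simp: max_pow_def)
  qed
qed

text \<open>\<open>Sup\<close> and \<open>Inf\<close> on the reals are meaningful here: the sets in \<open>inj_norm\<close> are bounded
  and those in \<open>proj_norm\<close> are nonempty (and bounded below by \<open>0\<close>).\<close>

lemma bdd_above_inj_norm:
  assumes "z \<in> tens_pow k"
  shows "bdd_above {\<bar>tens_app z \<phi>s\<bar> | \<phi>s. length \<phi>s = k \<and> (\<forall>\<phi>\<in>set \<phi>s. norm \<phi> \<le> 1)}"
proof -
  define S where "S = {\<phi>s :: ('a \<Rightarrow>\<^sub>L real) list. length \<phi>s = k \<and> (\<forall>\<phi>\<in>set \<phi>s. norm \<phi> \<le> 1)}"
  define T where "T = {z :: 'a tens. \<exists>M. \<forall>\<phi>s\<in>S. \<bar>tens_app z \<phi>s\<bar> \<le> M}"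
  have "subspace T"
  proof (rule subspaceI)
    show "0 \<in> T" by (auto simp: T_def)
    show "z + w \<in> T" if zw: "z \<in> T" "w \<in> T" for z w
    proof -
      obtain M N where "\<forall>\<phi>s\<in>S. \<bar>tens_app z \<phi>s\<bar> \<le> M" "\<forall>\<phi>s\<in>S. \<bar>tens_app w \<phi>s\<bar> \<le> N"
        using zw by (auto simp: T_def)
      then have "\<forall>\<phi>s\<in>S. \<bar>tens_app (z + w) \<phi>s\<bar> \<le> M + N"
        by (auto intro: order_trans[OF abs_triangle_ineq] add_mono)
      then show ?thesis by (auto simp: T_def)
    qed
    show "c *\<^sub>R z \<in> T" if z: "z \<in> T" for c z
    proof -
      obtain M where "\<forall>\<phi>s\<in>S. \<bar>tens_app z \<phi>s\<bar> \<le> M" using z by (auto simp: T_def)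
      then have "\<forall>\<phi>s\<in>S. \<bar>tens_app (c *\<^sub>R z) \<phi>s\<bar> \<le> \<bar>c\<bar> * M"
        by (auto simp: abs_mult intro!: mult_left_mono)
      then show ?thesis by (auto simp: T_def)
    qed
  qed
  moreover have "elem_tens xs \<in> T" if "length xs = k" for xs
  proof -
    have "\<bar>tens_app (elem_tens xs) \<phi>s\<bar> \<le> (\<Prod>i<k. norm (xs ! i))" if "\<phi>s \<in> S" for \<phi>s
    proof -
      have "norm (blinfun_apply (\<phi>s ! i) (xs ! i)) \<le> norm (xs ! i)" if "i < k" for i
        using \<open>\<phi>s \<in> S\<close> that norm_blinfun[of "\<phi>s ! i" "xs ! i"]
          mult_right_mono[of "norm (\<phi>s ! i)" 1 "norm (xs ! i)"]
        by (auto simp: S_def)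
      then show ?thesis
        using \<open>\<phi>s \<in> S\<close> \<open>length xs = k\<close>
        by (auto simp: elem_tens.rep_eq S_def abs_prod intro!: prod_mono)
    qed
    then show ?thesis by (auto simp: T_def)
  qed
  ultimately have "tens_pow k \<subseteq> T"
    unfolding tens_pow_def by (intro span_minimal) auto
  with assms obtain M where "\<forall>\<phi>s\<in>S. \<bar>tens_app z \<phi>s\<bar> \<le> M" by (auto simp: T_def)
  then show ?thesis by (intro bdd_aboveI[of _ M]) (auto simp: S_def)
qed

lemma tens_pow_decomposition:
  assumes "k \<ge> 1" "z \<in> tens_pow k"
  shows "\<exists>xss. (\<forall>xs\<in>set xss. length xs = k) \<and> z = (\<Sum>xs\<leftarrow>xss. elem_tens xs)"
  using assms(2) unfolding tens_pow_def
proof (induction rule: span_induct_alt)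
  case base
  show ?case by (rule exI[of _ "[]"]) simp
next
  case (step c b z)
  then obtain xs xss where *: "b = elem_tens xs" "length xs = k"
      "\<forall>xs\<in>set xss. length xs = k" "z = (\<Sum>xs\<leftarrow>xss. elem_tens xs)" by auto
  obtain y ys where xs: "xs = y # ys" using * assms(1) by (cases xs) auto
  have "c *\<^sub>R b = elem_tens ((c *\<^sub>R y) # ys)"
    unfolding *(1) xs elem_tens_Cons
    by (rule tens_eqI) (auto simp: tens_cons.rep_eq blinfun.scaleR_right split: list.split)
  then show ?case
    using * xs by (intro exI[of _ "((c *\<^sub>R y) # ys) # xss"]) auto
qed

end

theory Submission
  imports Defs
begin

text \<open>
  If \<open>P = \<Sum> c\<^sub>i x\<^sub>i \<otimes> w\<^sub>i\<close> with \<open>\<Sum> c\<^sub>i \<le> 1\<close>, \<open>\<parallel>x\<^sub>i\<parallel> \<le> 1\<close>, and \<open>v \<mapsto> \<Sum> c\<^sub>i w\<^sub>i(v)\<^sup>2\<close> is dominated by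
  \<open>\<Sum> d\<^sub>j \<mu>\<^sub>j(v)\<^sup>2\<close> with \<open>\<parallel>\<mu>\<^sub>j\<parallel> \<le> 1\<close>, \<open>\<Sum> d\<^sub>j \<le> \<beta>\<^sup>2\<close>, then the domination tensorizes, as for 2-summing maps, and the
  Cauchy--Schwarz inequality bounds the norm of \<open>P\<^sup>\<otimes>\<^sup>k\<close> from \<open>\<epsilon>\<^sub>k\<close> to \<open>\<pi>\<^sub>k\<close> by \<open>\<beta>\<^sup>k\<close>. Both inclusions
  follow with \<open>\<alpha> = \<beta>\<close>, whereas \<open>\<alpha> \<oplus> P\<close> is entanglement breaking only if the trace of \<open>P\<close> is at most \<open>\<alpha>\<close>.
  So it suffices to find such a \<open>P\<close> with trace greater than \<open>\<beta>\<close>.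

  Take a nuclear decomposition \<open>\<Sum> c\<^sub>i x\<^sub>i \<otimes> a\<^sub>i\<close> of a linear isomorphism \<open>\<real>\<^sup>E \<rightarrow> X\<close> whose cost \<open>S = \<Sum> c\<^sub>i\<close> is nearly
  the nuclear norm \<open>\<nu>\<close>, and the dual contraction \<open>T : X \<rightarrow> \<real>\<^sup>E\<close>, so that \<open>T x\<^sub>i\<close> is close to \<open>a\<^sub>i\<close>. With
  \<open>w\<^sub>i = \<langle>T \<cdot>, a\<^sub>i\<rangle>\<close> the trace and \<open>\<beta>\<close> are both about \<open>1\<close>. As \<open>X\<close> is not Euclidean,
  \<open>x \<mapsto> \<bar>T x\<bar>\<close> is not the norm of \<open>X\<close>, and there is \<open>h\<close> for which \<open>\<lambda> = \<langle>T \<cdot>, T h\<rangle> / \<nu>\<close> has norm at most \<open>1\<close> but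
  \<open>\<lambda>(h) > \<nu>\<close>. Replacing \<open>w\<^sub>i\<close> by \<open>(1 - s) w\<^sub>i + s \<langle>h, a\<^sub>i\<rangle> \<lambda>\<close> raises the trace to first order in \<open>s\<close> and \<open>\<beta>\<close> only
  to second order.
\<close>

section \<open>Coordinates and the Hahn--Banach theorem in finite dimension\<close>

text \<open>On the compact l1 unit sphere of coefficient vectors the norm of the linear combination
  attains its minimum, which is positive by independence; homogeneity does the rest.\<close>

lemma independent_coefficients_bounded:
  fixes E :: "'a::real_normed_vector set"
  assumes fin: "finite E" and ind: "independent E"
  obtains C where "0 < C" "\<And>u. (\<Sum>b\<in>E. \<bar>u b\<bar>) \<le> C * norm (\<Sum>b\<in>E. u b *\<^sub>R b)"
proof (cases "E = {}")
  case True
  then show ?thesis by (intro that[of 1]) auto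
next
  case False
  \<comment> \<open>Coefficients are functions on all of \<open>'a\<close>; pinning those outside
    \<open>E\<close> to 0 makes \<open>K\<close> a product of compact sets, so Tychonoff's theorem
    applies.\<close>
  define K where "K = (\<Pi>\<^sub>E b\<in>UNIV. if b \<in> E then {-1..1} else {0::real})"
  define K1 where "K1 = K \<inter> {u. (\<Sum>b\<in>E. \<bar>u b\<bar>) = 1}"
  define g where "g = (\<lambda>u. norm (\<Sum>b\<in>E. u b *\<^sub>R b))"
  have "compactin (product_topology (\<lambda>b. euclidean) UNIV) K"
    unfolding K_def by (subst compactin_PiE) auto
  then have "compact K" by (simp add: euclidean_product_topology)
  moreover have cont: "continuous_on UNIV (\<lambda>u. u b)" for b :: 'a
    by (rule continuous_on_product_coordinates)
  then have "closed {u. (\<Sum>b\<in>E. \<bar>u b\<bar>) = (1::real)}"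
    by (intro closed_Collect_eq continuous_intros) auto
  ultimately have K1: "compact K1" unfolding K1_def by (rule compact_Int_closed)
  obtain e where e: "e \<in> E" using False by blast
  have "(\<lambda>b. if b = e then 1 else 0) \<in> K1"
    using e fin by (auto simp: K1_def K_def if_distrib[of abs] cong: if_cong)
  then have ne: "K1 \<noteq> {}" by blast
  have "continuous_on K1 g"
    unfolding g_def by (intro continuous_intros continuous_on_subset[OF cont]) auto
  from continuous_attains_inf[OF K1 ne this]
  obtain u0 where u0: "u0 \<in> K1" "\<And>u. u \<in> K1 \<Longrightarrow> g u0 \<le> g u" by blast
  have "g u0 \<noteq> 0"
  proof
    assume "g u0 = 0"
    then have "(\<Sum>b\<in>E. u0 b *\<^sub>R b) = 0" by (simp add: g_def)
    then have "\<forall>b\<in>E. u0 b = 0"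
      using ind fin unfolding independent_explicit_finite_subsets by blast
    then show False using u0(1) by (simp add: K1_def)
  qed
  then have pos: "g u0 > 0" by (simp add: g_def)
  show ?thesis
  proof (rule that)
    show "0 < 1 / g u0" using pos by simp
    fix u :: "'a \<Rightarrow> real"
    define s where "s = (\<Sum>b\<in>E. \<bar>u b\<bar>)"
    show "(\<Sum>b\<in>E. \<bar>u b\<bar>) \<le> 1 / g u0 * norm (\<Sum>b\<in>E. u b *\<^sub>R b)"
    proof (cases "s = 0")
      case True
      then show ?thesis using pos by (simp add: s_def)
    next
      case False
      then have s: "s > 0" by (simp add: s_def sum_nonneg order_less_le)
      define v where "v = (\<lambda>b. if b \<in> E then u b / s else 0)"
      have le: "\<bar>u b\<bar> \<le> s" if "b \<in> E" for b
        unfolding s_def using fin that by (intro member_le_sum) auto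
      have "v \<in> K1"
        using s le fin by (auto simp: K1_def K_def v_def abs_le_iff divide_simps
            sum_divide_distrib[symmetric] abs_divide s_def[symmetric] minus_le_iff)
      then have "g u0 \<le> g v" by (rule u0(2))
      also have "(\<Sum>b\<in>E. v b *\<^sub>R b) = (1/s) *\<^sub>R (\<Sum>b\<in>E. u b *\<^sub>R b)"
        by (simp add: scaleR_sum_right v_def divide_inverse_commute)
      then have "g v = norm (\<Sum>b\<in>E. u b *\<^sub>R b) / s" using s by (simp add: g_def)
      finally show ?thesis using s pos by (simp add: s_def[symmetric] field_simps)
    qed
  qed
qed

text \<open>The preceding bound makes the coordinates with respect to a basis continuous, so they
  are elements of the dual space.\<close>

lemma bounded_coordinates:
  assumes "\<exists>B :: 'a set. finite B \<and> span B = UNIV"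
  obtains E and f :: "'a::real_normed_vector \<Rightarrow> 'a \<Rightarrow>\<^sub>L real"
  where "finite E" "\<And>v. (\<Sum>b\<in>E. blinfun_apply (f b) v *\<^sub>R b) = v"
proof -
  obtain B :: "'a set" where B: "finite B" "span B = UNIV" using assms by blast
  obtain E where E: "E \<subseteq> B" "independent E" "B \<subseteq> span E"
    using maximal_independent_subset by blast
  have fin: "finite E" using B(1) E(1) finite_subset by blast
  have sp: "span E = UNIV"
    using B(2) E(3) span_minimal[OF E(3)] by auto
  obtain C where C: "0 < C" "\<And>u. (\<Sum>b\<in>E. \<bar>u b\<bar>) \<le> C * norm (\<Sum>b\<in>E. u b *\<^sub>R b)"
    using independent_coefficients_bounded[OF fin E(2)] by metis
  have rep: "(\<Sum>b\<in>E. representation E v b *\<^sub>R b) = v" for v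
    using E(2) fin sp by (intro sum_representation_eq) auto
  have bl: "bounded_linear (\<lambda>v. representation E v b)" if b: "b \<in> E" for b
  proof (rule bounded_linear_intro)
    fix x y :: 'a and r :: real
    show "representation E (x + y) b = representation E x b + representation E y b"
      using E(2) sp by (simp add: representation_add)
    show "representation E (r *\<^sub>R x) b = r *\<^sub>R representation E x b"
      using E(2) sp by (simp add: representation_scale)
    have "\<bar>representation E x b\<bar> \<le> (\<Sum>b\<in>E. \<bar>representation E x b\<bar>)"
      using fin b by (intro member_le_sum) auto
    also have "\<dots> \<le> norm x * C" using C(2)[of "representation E x"] by (simp add: rep mult.commute)
    finally show "norm (representation E x b) \<le> norm x * C" by simp
  qed
  show ?thesis
  proof (rule that[OF fin])
    fix v
    have "(\<Sum>b\<in>E. blinfun_apply (Blinfun (\<lambda>v. representation E v b)) v *\<^sub>R b)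
        = (\<Sum>b\<in>E. representation E v b *\<^sub>R b)"
      by (intro sum.cong) (auto simp: bounded_linear_Blinfun_apply[OF bl])
    then show "(\<Sum>b\<in>E. blinfun_apply (Blinfun (\<lambda>v. representation E v b)) v *\<^sub>R b) = v"
      by (simp add: rep)
  qed
qed

section \<open>Sublinear functionals and their linear minorants\<close>

definition sublinear :: "('v::real_vector \<Rightarrow> real) \<Rightarrow> bool" where
  "sublinear p \<longleftrightarrow> (\<forall>x y. p (x + y) \<le> p x + p y) \<and> (\<forall>c x. 0 \<le> c \<longrightarrow> p (c *\<^sub>R x) = c * p x)"

lemma sublinear_zero: "sublinear p \<Longrightarrow> p 0 = 0"
  unfolding sublinear_def by (metis mult_zero_left order_refl scaleR_zero_left)

lemma sublinear_neg:
  assumes "sublinear p"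
  shows "- p (- x) \<le> p x"
proof -
  have "p (x + - x) \<le> p x + p (- x)" using assms unfolding sublinear_def by blast
  then show ?thesis using sublinear_zero[OF assms] by simp
qed

lemma sublinear_scale_neg:
  assumes "sublinear p" "p (- x) = - p x"
  shows "p (c *\<^sub>R x) = c * p x"
proof (cases "0 \<le> c")
  case True then show ?thesis using assms(1) by (simp add: sublinear_def)
next
  case False
  then have "p ((- c) *\<^sub>R (- x)) = - c * p (- x)" using assms(1) unfolding sublinear_def by (meson neg_0_le_iff_le linear)
  then show ?thesis using assms(2) by simp
qed

text \<open>A Hahn--Banach step that extends nothing from a subspace: the infimum of
  \<open>p (x + t *\<^sub>R u) - t * p u\<close> over t \<ge> 0 is again sublinear, keeps the value
  at \<open>u\<close> and is linear on the line through \<open>u\<close>.\<close>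

lemma sublinear_descend:
  fixes p :: "'v::real_vector \<Rightarrow> real"
  assumes p: "sublinear p"
  obtains q where "sublinear q" "\<And>x. q x \<le> p x" "q u = p u" "q (- u) = - q u"
proof -
  have add: "p (x + y) \<le> p x + p y" for x y using p by (simp add: sublinear_def)
  have scale: "p (c *\<^sub>R x) = c * p x" if "0 \<le> c" for c x using p that by (simp add: sublinear_def)
  define S where "S x = {p (x + t *\<^sub>R u) - t * p u | t. 0 \<le> t}" for x
  define q where "q x = Inf (S x)" for x
  \<comment> \<open>Subadditivity gives a lower bound independent of \<open>t\<close>, so the
    infimum is finite.\<close>
  have lb: "- p (- x) \<le> s" if s: "s \<in> S x" for s x
  proof -
    obtain t where t: "s = p (x + t *\<^sub>R u) - t * p u" "0 \<le> t" using s by (auto simp: S_def)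
    have "p (t *\<^sub>R u) \<le> p (x + t *\<^sub>R u) + p (- x)" using add[of "x + t *\<^sub>R u" "- x"] by simp
    then show ?thesis using t scale by simp
  qed
  have ne: "S x \<noteq> {}" for x by (auto simp: S_def)
  have bdd: "bdd_below (S x)" for x using lb by (intro bdd_belowI) auto
  have low: "q x \<le> p (x + t *\<^sub>R u) - t * p u" if "0 \<le> t" for x t
    unfolding q_def using that by (intro cInf_lower bdd) (auto simp: S_def)
  have ge: "m \<le> q x" if "\<And>t. 0 \<le> t \<Longrightarrow> m \<le> p (x + t *\<^sub>R u) - t * p u" for m x
    unfolding q_def using that by (intro cInf_greatest ne) (auto simp: S_def)
  have qp: "q x \<le> p x" for x using low[of 0 x] by simp
  have qadd: "q (x + y) \<le> q x + q y" for x y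
  proof -
    have "q (x + y) - (p (y + r *\<^sub>R u) - r * p u) \<le> q x" if r: "0 \<le> r" for r
    proof (rule ge)
      fix t :: real assume t: "0 \<le> t"
      have "q (x + y) \<le> p ((x + y) + (t + r) *\<^sub>R u) - (t + r) * p u" using t r by (intro low) auto
      also have "p ((x + y) + (t + r) *\<^sub>R u) \<le> p (x + t *\<^sub>R u) + p (y + r *\<^sub>R u)"
        using add[of "x + t *\<^sub>R u" "y + r *\<^sub>R u"] by (simp add: algebra_simps)
      finally show "q (x + y) - (p (y + r *\<^sub>R u) - r * p u) \<le> p (x + t *\<^sub>R u) - t * p u"
        by (simp add: algebra_simps)
    qed
    then have "q (x + y) - q x \<le> q y" by (intro ge) (smt (verit))
    then show ?thesis by simp
  qed
  have "0 \<le> q 0" using scale by (intro ge) simp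
  then have q0: "q 0 = 0" using qp[of 0] sublinear_zero[OF p] by simp
  have qle: "q (c *\<^sub>R x) \<le> c * q x" if c: "0 < c" for c x
  proof -
    have "q (c *\<^sub>R x) / c \<le> q x"
    proof (rule ge)
      fix t :: real assume t: "0 \<le> t"
      have "q (c *\<^sub>R x) \<le> p (c *\<^sub>R x + (c * t) *\<^sub>R u) - (c * t) * p u" using t c by (intro low) auto
      also have "p (c *\<^sub>R x + (c * t) *\<^sub>R u) = c * p (x + t *\<^sub>R u)"
        using scale[of c "x + t *\<^sub>R u"] c by (simp add: algebra_simps)
      finally show "q (c *\<^sub>R x) / c \<le> p (x + t *\<^sub>R u) - t * p u" using c by (simp add: field_simps)
    qed
    then show ?thesis using c by (simp add: field_simps)
  qed
  have qscale: "q (c *\<^sub>R x) = c * q x" if c: "0 \<le> c" for c x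
  proof (cases "c = 0")
    case True then show ?thesis using q0 by simp
  next
    case False
    then have c: "c > 0" using c by simp
    have "q x \<le> (1 / c) * q (c *\<^sub>R x)" using qle[of "1/c" "c *\<^sub>R x"] c by simp
    then have "c * q x \<le> q (c *\<^sub>R x)" using c by (simp add: field_simps)
    then show ?thesis using qle[OF c, of x] by simp
  qed
  have sq: "sublinear q" using qadd qscale by (simp add: sublinear_def)
  have "p u \<le> q u"
  proof (rule ge)
    fix t :: real assume t: "0 \<le> t"
    have "p (u + t *\<^sub>R u) = (1 + t) * p u" using scale[of "1 + t" u] t by (simp add: algebra_simps)
    then show "p u \<le> p (u + t *\<^sub>R u) - t * p u" by (simp add: algebra_simps)
  qed
  then have qu: "q u = p u" using qp[of u] by simp
  \<comment> \<open>At \<open>- u\<close> the choice t = 1 leaves \<open>p 0 - p u\<close>.\<close>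
  have "q (- u) \<le> - p u" using low[of 1 "- u"] sublinear_zero[OF p] by simp
  then have "q (- u) = - q u" using sublinear_neg[OF sq, of u] qu by simp
  then show ?thesis using that sq qp qu by blast
qed

text \<open>The chain \<open>- q (- u) \<le> q u \<le> p u = - p (- u) \<le> - q (- u)\<close>
  collapses to equalities. Later descent steps therefore preserve values and oddness already
  secured.\<close>

lemma sublinear_minorant_neg:
  assumes "sublinear q" "sublinear p" "\<And>x. q x \<le> p x" "p (- u) = - p u"
  shows "q u = p u" "q (- u) = - q u"
  using assms(3)[of u] assms(3)[of "- u"] sublinear_neg[OF assms(1), of u] assms(4) by linarith+

text \<open>Passing to smaller sublinear functionals one vector at a time keeps the linearity already
  achieved, so finitely many steps produce a linear functional.\<close>

lemma Hahn_Banach_finite_dim: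
  fixes p :: "'v::real_vector \<Rightarrow> real"
  assumes p: "sublinear p" and G: "finite (G :: 'v set)" "span G = UNIV"
  obtains F where "linear F" "\<And>x. F x \<le> p x" "F u = p u"
proof -
  \<comment> \<open>The vector \<open>u\<close> is handled in the base case, so the value
    \<open>p u\<close> is fixed before any vector of \<open>G\<close> is processed.\<close>
  have "\<exists>q. sublinear q \<and> (\<forall>x. q x \<le> p x) \<and> q u = p u \<and> (\<forall>v\<in>insert u G. q (- v) = - q v)"
    using G(1)
  proof induction
    case empty
    then show ?case using sublinear_descend[OF p, of u] by (metis insertE empty_iff)
  next
    case (insert w G)
    then obtain q where q: "sublinear q" "\<forall>x. q x \<le> p x" "q u = p u" "\<forall>v\<in>insert u G. q (- v) = - q v"
      by blast
    obtain r where r: "sublinear r" "\<And>x. r x \<le> q x" "r w = q w" "r (- w) = - r w"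
      using sublinear_descend[OF q(1), of w] by blast
    have "r v = q v \<and> r (- v) = - r v" if "v \<in> insert u G" for v
      using sublinear_minorant_neg[OF r(1) q(1) r(2)] q(4) that by blast
    then show ?case using r q by (intro exI[of _ r]) (auto intro: order_trans)
  qed
  then obtain q where q: "sublinear q" "\<And>x. q x \<le> p x" "q u = p u" "\<forall>v\<in>G. q (- v) = - q v"
    by blast
  have add: "q (x + y) \<le> q x + q y" for x y using q(1) by (simp add: sublinear_def)
  \<comment> \<open>Where \<open>q\<close> is odd, subadditivity at two vectors and at their
    negatives forces additivity, so oddness spreads from generators to their span.\<close>
  have "subspace {v. q (- v) = - q v}"
  proof (rule subspaceI)
    show "0 \<in> {v. q (- v) = - q v}" using sublinear_zero[OF q(1)] by simp
    show "x + y \<in> {v. q (- v) = - q v}" if "x \<in> {v. q (- v) = - q v}" "y \<in> {v. q (- v) = - q v}" for x y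
      using that add[of x y] add[of "- x" "- y"] sublinear_neg[OF q(1), of "x + y"] by simp
    show "c *\<^sub>R x \<in> {v. q (- v) = - q v}" if "x \<in> {v. q (- v) = - q v}" for c x
      using that sublinear_scale_neg[OF q(1), of x c] sublinear_scale_neg[OF q(1), of x "- c"] by simp
  qed
  then have "span G \<subseteq> {v. q (- v) = - q v}" using q(4) by (intro span_minimal) auto
  then have neg: "q (- v) = - q v" for v using G(2) by blast
  have "linear q"
  proof (rule linearI)
    show "q (x + y) = q x + q y" for x y
      using add[of x y] add[of "- x" "- y"] neg[of x] neg[of y] neg[of "x + y"] by simp
    show "q (c *\<^sub>R x) = c *\<^sub>R q x" for c x using sublinear_scale_neg[OF q(1) neg] by simp
  qed
  then show ?thesis using that q by blast
qed

section \<open>Two-summing domination of tensor powers\<close>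

lemma weighted_Cauchy_Schwarz:
  fixes c :: "'i \<Rightarrow> real"
  assumes "\<And>i. i \<in> A \<Longrightarrow> 0 \<le> c i"
  shows "(\<Sum>i\<in>A. c i * u i * v i)\<^sup>2 \<le> (\<Sum>i\<in>A. c i * (u i)\<^sup>2) * (\<Sum>i\<in>A. c i * (v i)\<^sup>2)"
proof -
  have "(\<Sum>i\<in>A. c i * u i * v i) = (\<Sum>i\<in>A. (sqrt (c i) * u i) * (sqrt (c i) * v i))"
  proof (rule sum.cong)
    fix i assume "i \<in> A"
    from assms[OF this] have "sqrt (c i) * sqrt (c i) = c i" by simp
    then show "c i * u i * v i = (sqrt (c i) * u i) * (sqrt (c i) * v i)"
      by (metis mult.assoc mult.left_commute)
  qed simp
  also have "\<dots>\<^sup>2 \<le> (\<Sum>i\<in>A. (sqrt (c i) * u i)\<^sup>2) * (\<Sum>i\<in>A. (sqrt (c i) * v i)\<^sup>2)"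
    by (rule Cauchy_Schwarz_ineq_sum)
  finally show ?thesis using assms by (simp add: power_mult_distrib)
qed

text \<open>Lists over \<open>A\<close> serve as multi-indices for tensor powers; splitting off the
  head drives the inductions on \<open>k\<close>.\<close>

lemma sum_lists_Suc:
  assumes "finite A"
  shows "(\<Sum>I | set I \<subseteq> A \<and> length I = Suc k. f I)
    = (\<Sum>i\<in>A. \<Sum>I | set I \<subseteq> A \<and> length I = k. f (i # I))"
proof -
  have "(\<Sum>I | set I \<subseteq> A \<and> length I = Suc k. f I)
      = (\<Sum>(I, i) \<in> {I. set I \<subseteq> A \<and> length I = k} \<times> A. f (i # I))"
    unfolding lists_length_Suc_eq
    by (subst sum.reindex) (auto simp: inj_on_def intro!: sum.cong)
  also have "\<dots> = (\<Sum>I | set I \<subseteq> A \<and> length I = k. \<Sum>i\<in>A. f (i # I))"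
    by (rule sum.cartesian_product[symmetric])
  also have "\<dots> = (\<Sum>i\<in>A. \<Sum>I | set I \<subseteq> A \<and> length I = k. f (i # I))"
    by (rule sum.swap)
  finally show ?thesis .
qed

lemma lists_length_0: "{I. set I \<subseteq> A \<and> length I = 0} = {[]}"
  by auto

lemma sum_prod_list_lists:
  fixes d :: "'i \<Rightarrow> real"
  assumes "finite A"
  shows "(\<Sum>I | set I \<subseteq> A \<and> length I = k. prod_list (map d I)) = (\<Sum>i\<in>A. d i) ^ k"
proof (induction k)
  case 0
  show ?case unfolding lists_length_0 by simp
next
  case (Suc k)
  then show ?case
    unfolding sum_lists_Suc[OF assms]
    by (simp add: sum_distrib_left[symmetric] sum_distrib_right[symmetric])
qed

text \<open>With all later slots frozen, a tensor acts on its first slot as evaluation at a vector.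
  Inequalities assumed for vectors thus become available slot by slot.\<close>

lemma tens_app_Cons:
  assumes "z \<in> tens_pow (Suc k)"
  shows "\<exists>v. \<forall>\<phi>. tens_app z (\<phi> # \<psi>s) = blinfun_apply \<phi> v"
  using assms unfolding tens_pow_def
proof (induction rule: span_induct_alt)
  case base
  show ?case by (rule exI[of _ 0]) simp
next
  case (step c b z)
  then obtain x xs v where "b = elem_tens (x # xs)" "\<And>\<phi>. tens_app z (\<phi> # \<psi>s) = blinfun_apply \<phi> v"
    by (auto simp: length_Suc_conv)
  then show ?case
    by (intro exI[of _ "(c * tens_app (elem_tens xs) \<psi>s) *\<^sub>R x + v"])
       (simp add: elem_tens_Cons tens_cons.rep_eq blinfun.add_right blinfun.scaleR_right)
qed

text \<open>The slots are exchanged one at a time: the induction hypothesis, applied to the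
  contractions by \<open>w i\<close>, replaces the tail, and \<open>dom\<close>, at the vector
  supplied by \<open>tens_app_Cons\<close>, replaces the head.\<close>

lemma tens_second_moment_le:
  fixes w :: "'i \<Rightarrow> 'a::real_normed_vector \<Rightarrow>\<^sub>L real" and \<mu> :: "'j \<Rightarrow> 'a \<Rightarrow>\<^sub>L real"
  assumes fin: "finite A" "finite J"
    and c: "\<And>i. i \<in> A \<Longrightarrow> 0 \<le> c i" and d: "\<And>j. j \<in> J \<Longrightarrow> 0 \<le> d j"
    and dom: "\<And>v. (\<Sum>i\<in>A. c i * (w i v)\<^sup>2) \<le> (\<Sum>j\<in>J. d j * (\<mu> j v)\<^sup>2)"
    and z: "z \<in> tens_pow k"
  shows "(\<Sum>I | set I \<subseteq> A \<and> length I = k. prod_list (map c I) * (tens_app z (map w I))\<^sup>2)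
    \<le> (\<Sum>K | set K \<subseteq> J \<and> length K = k. prod_list (map d K) * (tens_app z (map \<mu> K))\<^sup>2)"
  using z
proof (induction k arbitrary: z)
  case 0
  show ?case unfolding lists_length_0 by simp
next
  case (Suc k)
  let ?L = "{I. set I \<subseteq> A \<and> length I = k}" and ?M = "{K. set K \<subseteq> J \<and> length K = k}"
  have dK: "0 \<le> prod_list (map d K)" if "K \<in> ?M" for K
    using that d by (intro prod_list_nonneg) auto
  have "(\<Sum>I | set I \<subseteq> A \<and> length I = Suc k. prod_list (map c I) * (tens_app z (map w I))\<^sup>2)
      = (\<Sum>i\<in>A. c i * (\<Sum>I\<in>?L. prod_list (map c I) * (tens_app (tens_contract (w i) z) (map w I))\<^sup>2))"
    unfolding sum_lists_Suc[OF fin(1)] by (simp add: tens_contract.rep_eq sum_distrib_left mult.assoc)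
  also have "\<dots> \<le> (\<Sum>i\<in>A. c i * (\<Sum>K\<in>?M. prod_list (map d K) * (tens_app (tens_contract (w i) z) (map \<mu> K))\<^sup>2))"
    using Suc.prems c by (intro sum_mono mult_left_mono Suc.IH tens_contract_tens_pow) auto
  also have "\<dots> = (\<Sum>K\<in>?M. prod_list (map d K) * (\<Sum>i\<in>A. c i * (tens_app z (w i # map \<mu> K))\<^sup>2))"
    unfolding sum_distrib_left
    by (subst sum.swap) (simp add: tens_contract.rep_eq mult.left_commute)
  also have "\<dots> \<le> (\<Sum>K\<in>?M. prod_list (map d K) * (\<Sum>j\<in>J. d j * (tens_app z (\<mu> j # map \<mu> K))\<^sup>2))"
  proof (intro sum_mono mult_left_mono dK)
    fix K
    obtain v where "\<And>\<phi>. tens_app z (\<phi> # map \<mu> K) = blinfun_apply \<phi> v"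
      using tens_app_Cons[OF Suc.prems] by metis
    then show "(\<Sum>i\<in>A. c i * (tens_app z (w i # map \<mu> K))\<^sup>2)
        \<le> (\<Sum>j\<in>J. d j * (tens_app z (\<mu> j # map \<mu> K))\<^sup>2)"
      using dom by simp
  qed
  also have "\<dots> = (\<Sum>K | set K \<subseteq> J \<and> length K = Suc k. prod_list (map d K) * (tens_app z (map \<mu> K))\<^sup>2)"
    unfolding sum_lists_Suc[OF fin(2)] sum_distrib_left
    by (subst sum.swap) (simp add: mult_ac)
  finally show ?case .
qed

lemma linear_tens_cons_left: "linear (\<lambda>x. tens_cons x z)"
  by (rule linearI; rule tens_eqI)
     (simp_all add: tens_cons.rep_eq blinfun.add_right blinfun.scaleR_right algebra_simps split: list.split)

text \<open>Both sides are linear in \<open>z\<close>, so elementary tensors suffice; there the sums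
  for \<open>P\<close> in the \<open>k\<close> factors multiply out over multi-indices.\<close>

lemma tens_map_finite_rank:
  fixes P :: "'a::real_normed_vector \<Rightarrow>\<^sub>L 'a" and w :: "'i \<Rightarrow> 'a \<Rightarrow>\<^sub>L real"
  assumes fin: "finite A"
    and P: "\<And>v. P v = (\<Sum>i\<in>A. (c i * w i v) *\<^sub>R x i)"
    and z: "z \<in> tens_pow k"
  shows "tens_map P z = (\<Sum>I | set I \<subseteq> A \<and> length I = k.
    (prod_list (map c I) * tens_app z (map w I)) *\<^sub>R elem_tens (map x I))"
proof (rule linear_eq_on[where f = "tens_map P"])
  show "linear (tens_map P)" by (rule linear_tens_map)
  show "linear (\<lambda>z. \<Sum>I | set I \<subseteq> A \<and> length I = k.
      (prod_list (map c I) * tens_app z (map w I)) *\<^sub>R elem_tens (map x I))"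
    by (rule linearI)
       (simp_all add: algebra_simps sum.distrib scaleR_sum_right)
  show "z \<in> span (elem_tens ` {xs. length xs = k})" using z by (simp add: tens_pow_def)
  fix b :: "'a tens"
  assume "b \<in> elem_tens ` {xs. length xs = k}"
  then obtain xs where b: "b = elem_tens xs" "length xs = k" by auto
  have "elem_tens (map (blinfun_apply P) xs) = (\<Sum>I | set I \<subseteq> A \<and> length I = k.
      (prod_list (map c I) * tens_app (elem_tens xs) (map w I)) *\<^sub>R elem_tens (map x I))"
    using b(2)
  proof (induction k arbitrary: xs)
    case 0
    then show ?case unfolding lists_length_0 by (simp add: elem_tens.rep_eq)
  next
    case (Suc k)
    then obtain y ys where xs: "xs = y # ys" "length ys = k" by (auto simp: length_Suc_conv)
    have "elem_tens (map (blinfun_apply P) xs)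
        = (\<Sum>i\<in>A. (c i * w i y) *\<^sub>R tens_cons (x i) (elem_tens (map (blinfun_apply P) ys)))"
      by (simp add: xs elem_tens_Cons P linear_sum[OF linear_tens_cons_left]
          linear_scale[OF linear_tens_cons_left])
    then show ?case
      unfolding sum_lists_Suc[OF fin] Suc.IH[OF xs(2)]
      by (simp add: xs elem_tens_Cons tens_cons.rep_eq linear_sum[OF linear_tens_cons]
          linear_scale[OF linear_tens_cons] scaleR_sum_right mult_ac)
  qed
  then show "tens_map P b = (\<Sum>I | set I \<subseteq> A \<and> length I = k.
      (prod_list (map c I) * tens_app b (map w I)) *\<^sub>R elem_tens (map x I))"
    by (simp add: b tens_map_elem_tens)
qed

lemma abs_tens_app_le_inj_norm:
  assumes "z \<in> tens_pow k" "length \<phi>s = k" "\<forall>\<phi>\<in>set \<phi>s. norm \<phi> \<le> 1"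
  shows "\<bar>tens_app z \<phi>s\<bar> \<le> inj_norm k z"
  unfolding inj_norm_def using assms(2,3) by (intro cSup_upper bdd_above_inj_norm[OF assms(1)]) auto

lemma inj_norm_nonneg: "z \<in> tens_pow k \<Longrightarrow> 0 \<le> inj_norm k z"
  using abs_tens_app_le_inj_norm[of z k "replicate k 0"] abs_ge_zero order_trans
  by (metis length_replicate in_set_replicate norm_zero zero_le_one)

text \<open>The norm of \<open>P\<^sup>\<otimes>\<^sup>k\<close> from \<open>\<epsilon>\<^sub>k\<close> to \<open>\<pi>\<^sub>k\<close> is at most \<open>\<beta>\<^sup>k\<close>.\<close>

definition inj_proj_bounded :: "real \<Rightarrow> ('a::real_normed_vector \<Rightarrow>\<^sub>L 'a) \<Rightarrow> bool" where
  "inj_proj_bounded \<beta> P \<longleftrightarrow> (\<forall>k. \<forall>z\<in>tens_pow k. \<exists>(S :: nat list set) r y. finite S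
    \<and> (\<forall>I\<in>S. length (y I) = k \<and> (\<forall>v\<in>set (y I). norm v \<le> 1))
    \<and> tens_map P z = (\<Sum>I\<in>S. r I *\<^sub>R elem_tens (y I)) \<and> (\<Sum>I\<in>S. \<bar>r I\<bar>) \<le> \<beta> ^ k * inj_norm k z)"

lemma inj_proj_boundedE:
  assumes "inj_proj_bounded \<beta> P" "z \<in> tens_pow k"
  obtains S :: "nat list set" and r y where "finite S"
    "\<forall>I\<in>S. length (y I) = k \<and> (\<forall>v\<in>set (y I). norm v \<le> 1)"
    "tens_map P z = (\<Sum>I\<in>S. r I *\<^sub>R elem_tens (y I))" "(\<Sum>I\<in>S. \<bar>r I\<bar>) \<le> \<beta> ^ k * inj_norm k z"
  using assms(1)[unfolded inj_proj_bounded_def, THEN spec, THEN bspec, OF assms(2)]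
  by (elim exE conjE) (rule that)

text \<open>The multi-index expansion of \<open>tens_map P z\<close> has total coefficient at most
  the root of (sum of weights) times (second moment), by Cauchy--Schwarz; the weights sum to at most
  1 and the tensorized domination bounds the moment by the square of
  \<open>\<beta> ^ k * inj_norm k z\<close>. An explicit decomposition is kept because the inclusion
  into \<open>min_pow\<close> needs actual summands.\<close>

lemma two_summing_inj_proj_bounded:
  fixes P :: "'a::real_normed_vector \<Rightarrow>\<^sub>L 'a" and A :: "nat set" and w :: "nat \<Rightarrow> 'a \<Rightarrow>\<^sub>L real" and \<mu> :: "'j \<Rightarrow> 'a \<Rightarrow>\<^sub>L real"
  assumes fin: "finite A" "finite J"
    and P: "\<And>v. P v = (\<Sum>i\<in>A. (c i * w i v) *\<^sub>R x i)"
    and c: "\<And>i. i \<in> A \<Longrightarrow> 0 \<le> c i" "(\<Sum>i\<in>A. c i) \<le> 1"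
    and x: "\<And>i. i \<in> A \<Longrightarrow> norm (x i) \<le> 1"
    and d: "\<And>j. j \<in> J \<Longrightarrow> 0 \<le> d j" "(\<Sum>j\<in>J. d j) \<le> \<beta>\<^sup>2" and \<beta>: "0 \<le> \<beta>"
    and \<mu>: "\<And>j. j \<in> J \<Longrightarrow> norm (\<mu> j) \<le> 1"
    and dom: "\<And>v. (\<Sum>i\<in>A. c i * (w i v)\<^sup>2) \<le> (\<Sum>j\<in>J. d j * (\<mu> j v)\<^sup>2)"
  shows "inj_proj_bounded \<beta> P"
  unfolding inj_proj_bounded_def
proof (intro allI ballI)
  fix k and z :: "'a tens"
  assume z: "z \<in> tens_pow k"
  let ?L = "{I. set I \<subseteq> A \<and> length I = k}" and ?K = "{K. set K \<subseteq> J \<and> length K = k}"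
  let ?c = "\<lambda>I. prod_list (map c I)" and ?z = "\<lambda>I. tens_app z (map w I)"
  let ?M = "inj_norm k z"
  have cI: "0 \<le> ?c I" if "I \<in> ?L" for I using that c(1) by (intro prod_list_nonneg) auto
  have dK: "0 \<le> prod_list (map d K)" if "K \<in> ?K" for K using that d(1) by (intro prod_list_nonneg) auto
  have M: "0 \<le> ?M" by (rule inj_norm_nonneg[OF z])
  have "(\<Sum>I\<in>?L. ?c I * (?z I)\<^sup>2) \<le> (\<Sum>K\<in>?K. prod_list (map d K) * (tens_app z (map \<mu> K))\<^sup>2)"
    by (rule tens_second_moment_le[OF fin c(1) d(1) dom z])
  also have "\<dots> \<le> (\<Sum>K\<in>?K. prod_list (map d K) * ?M\<^sup>2)"
  proof (intro sum_mono mult_left_mono dK)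
    fix K assume K: "K \<in> ?K"
    have "\<bar>tens_app z (map \<mu> K)\<bar> \<le> ?M" using K \<mu> by (intro abs_tens_app_le_inj_norm[OF z]) auto
    then show "(tens_app z (map \<mu> K))\<^sup>2 \<le> ?M\<^sup>2" by (metis abs_ge_zero power2_abs power_mono)
  qed
  also have "\<dots> = (\<Sum>j\<in>J. d j) ^ k * ?M\<^sup>2"
    by (simp add: sum_distrib_right[symmetric] sum_prod_list_lists[OF fin(2)])
  also have "\<dots> \<le> (\<beta>\<^sup>2) ^ k * ?M\<^sup>2"
    using d by (intro mult_right_mono power_mono sum_nonneg) auto
  finally have 2: "(\<Sum>I\<in>?L. ?c I * (?z I)\<^sup>2) \<le> (\<beta> ^ k * ?M)\<^sup>2"
    by (simp add: power_mult_distrib power_mult[symmetric] mult.commute)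
  have "(\<Sum>I\<in>?L. \<bar>?c I * ?z I\<bar>) = (\<Sum>I\<in>?L. ?c I * 1 * \<bar>?z I\<bar>)"
  proof (rule sum.cong)
    fix I assume "I \<in> ?L"
    from cI[OF this] show "\<bar>?c I * ?z I\<bar> = ?c I * 1 * \<bar>?z I\<bar>" by (simp add: abs_mult)
  qed simp
  then have "(\<Sum>I\<in>?L. \<bar>?c I * ?z I\<bar>)\<^sup>2 \<le> (\<Sum>I\<in>?L. ?c I) * (\<Sum>I\<in>?L. ?c I * (?z I)\<^sup>2)"
    using weighted_Cauchy_Schwarz[of ?L ?c "\<lambda>_. 1" "\<lambda>I. \<bar>?z I\<bar>"] cI by simp
  also have "(\<Sum>I\<in>?L. ?c I) = (\<Sum>i\<in>A. c i) ^ k" by (rule sum_prod_list_lists[OF fin(1)])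
  also have "(\<Sum>i\<in>A. c i) ^ k * (\<Sum>I\<in>?L. ?c I * (?z I)\<^sup>2) \<le> 1 * (\<beta> ^ k * ?M)\<^sup>2"
    using c cI by (intro mult_mono 2 power_le_one sum_nonneg) auto
  finally have "(\<Sum>I\<in>?L. \<bar>?c I * ?z I\<bar>) \<le> \<beta> ^ k * ?M"
    using M \<beta> by (simp add: abs_le_square_iff[symmetric] power2_le_iff_abs_le)
  moreover have "length (map x I) = k \<and> (\<forall>v\<in>set (map x I). norm v \<le> 1)" if "I \<in> ?L" for I
    using that x by auto
  moreover have "finite ?L" using fin(1) by (rule finite_lists_length_eq)
  ultimately show "\<exists>(S :: nat list set) r y. finite S
      \<and> (\<forall>I\<in>S. length (y I) = k \<and> (\<forall>v\<in>set (y I). norm v \<le> 1))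
      \<and> tens_map P z = (\<Sum>I\<in>S. r I *\<^sub>R elem_tens (y I)) \<and> (\<Sum>I\<in>S. \<bar>r I\<bar>) \<le> \<beta> ^ k * ?M"
    using tens_map_finite_rank[OF fin(1) P z]
    by (intro exI[of _ ?L] exI[of _ "\<lambda>I. ?c I * ?z I"] exI[of _ "map x"]) blast
qed

text \<open>The same estimate for a single factor, carried out on vectors. It makes
  \<open>scal_oplus \<beta> P\<close> preserve \<open>norm_cone\<close>.\<close>

lemma two_summing_norm_le:
  fixes P :: "'a::real_normed_vector \<Rightarrow>\<^sub>L 'a" and w :: "'i \<Rightarrow> 'a \<Rightarrow>\<^sub>L real" and \<mu> :: "'j \<Rightarrow> 'a \<Rightarrow>\<^sub>L real"
  assumes P: "\<And>v. P v = (\<Sum>i\<in>A. (c i * w i v) *\<^sub>R x i)"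
    and c: "\<And>i. i \<in> A \<Longrightarrow> 0 \<le> c i" "(\<Sum>i\<in>A. c i) \<le> 1"
    and x: "\<And>i. i \<in> A \<Longrightarrow> norm (x i) \<le> 1"
    and d: "\<And>j. j \<in> J \<Longrightarrow> 0 \<le> d j" "(\<Sum>j\<in>J. d j) \<le> \<beta>\<^sup>2" and \<beta>: "0 \<le> \<beta>"
    and \<mu>: "\<And>j. j \<in> J \<Longrightarrow> norm (\<mu> j) \<le> 1"
    and dom: "\<And>v. (\<Sum>i\<in>A. c i * (w i v)\<^sup>2) \<le> (\<Sum>j\<in>J. d j * (\<mu> j v)\<^sup>2)"
  shows "norm (P v) \<le> \<beta> * norm v"
proof -
  have "\<bar>\<mu> j v\<bar> \<le> norm v" if "j \<in> J" for j
    using norm_blinfun[of "\<mu> j" v] mult_right_mono[OF \<mu>[OF that], of "norm v"] by simp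
  then have sq: "(\<mu> j v)\<^sup>2 \<le> (norm v)\<^sup>2" if "j \<in> J" for j
    using that by (simp add: abs_le_square_iff[symmetric])
  have "norm (P v) \<le> (\<Sum>i\<in>A. norm ((c i * w i v) *\<^sub>R x i))"
    unfolding P by (rule norm_sum)
  also have "\<dots> \<le> (\<Sum>i\<in>A. c i * 1 * \<bar>w i v\<bar>)"
  proof (rule sum_mono)
    fix i assume i: "i \<in> A"
    have "norm ((c i * w i v) *\<^sub>R x i) = (c i * \<bar>w i v\<bar>) * norm (x i)" using c(1)[OF i] by (simp add: abs_mult)
    also have "\<dots> \<le> (c i * \<bar>w i v\<bar>) * 1" using x[OF i] c(1)[OF i] by (intro mult_left_mono) auto
    finally show "norm ((c i * w i v) *\<^sub>R x i) \<le> c i * 1 * \<bar>w i v\<bar>" by simp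
  qed
  finally have "(norm (P v))\<^sup>2 \<le> (\<Sum>i\<in>A. c i * 1 * \<bar>w i v\<bar>)\<^sup>2"
    by (intro power_mono) auto
  also have "\<dots> \<le> (\<Sum>i\<in>A. c i) * (\<Sum>i\<in>A. c i * (w i v)\<^sup>2)"
    using weighted_Cauchy_Schwarz[of A c "\<lambda>_. 1" "\<lambda>i. \<bar>w i v\<bar>"] c(1) by simp
  also have "\<dots> \<le> 1 * (\<Sum>j\<in>J. d j * (\<mu> j v)\<^sup>2)"
    using c d by (intro mult_mono dom sum_nonneg) auto
  also have "\<dots> \<le> (\<Sum>j\<in>J. d j * (norm v)\<^sup>2)"
    using d(1) sq by (auto intro!: sum_mono mult_left_mono)
  also have "\<dots> \<le> \<beta>\<^sup>2 * (norm v)\<^sup>2"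
    using d(2) by (simp add: sum_distrib_right[symmetric] mult_right_mono)
  finally have "(norm (P v))\<^sup>2 \<le> (\<beta> * norm v)\<^sup>2" by (simp add: power_mult_distrib)
  from power2_le_imp_le[OF this] show ?thesis using \<beta> by simp
qed

lemma proj_norm_le:
  fixes y :: "'i \<Rightarrow> 'a::real_normed_vector list"
  assumes S: "finite S" and k: "k \<ge> 1"
    and y: "\<forall>I\<in>S. length (y I) = k \<and> (\<forall>v\<in>set (y I). norm v \<le> 1)"
  shows "proj_norm k (\<Sum>I\<in>S. r I *\<^sub>R elem_tens (y I)) \<le> (\<Sum>I\<in>S. \<bar>r I\<bar>)"
proof -
  obtain L where L: "set L = S" "distinct L" using finite_distinct_list[OF S] by blast
  \<comment> \<open>The coefficient moves into the first factor, since \<open>proj_norm\<close>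
    ranges over sums of bare elementary tensors; a first factor exists because k \<ge> 1.\<close>
  define g where "g I = (r I *\<^sub>R hd (y I)) # tl (y I)" for I
  have ne: "y I = hd (y I) # tl (y I)" if "I \<in> S" for I using y that k by (cases "y I") auto
  have g: "elem_tens (g I) = r I *\<^sub>R elem_tens (y I)" "length (g I) = k"
      "prod_list (map norm (g I)) \<le> \<bar>r I\<bar>" if I: "I \<in> S" for I
  proof -
    obtain v vs where v: "y I = v # vs" using ne[OF I] by metis
    show "elem_tens (g I) = r I *\<^sub>R elem_tens (y I)"
      by (simp add: g_def v elem_tens_Cons linear_scale[OF linear_tens_cons_left])
    show "length (g I) = k" using bspec[OF y I] v by (simp add: g_def)
    have "prod_list (map norm us) \<le> 1" if "\<forall>u\<in>set us. norm u \<le> 1" for us :: "'a list"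
      using that by (induction us) (auto intro!: mult_le_one prod_list_nonneg)
    moreover have "\<forall>u\<in>set (y I). norm u \<le> 1" using y I by blast
    ultimately have "prod_list (map norm (y I)) \<le> 1" by blast
    then have "\<bar>r I\<bar> * prod_list (map norm (y I)) \<le> \<bar>r I\<bar> * 1" by (intro mult_left_mono) auto
    then show "prod_list (map norm (g I)) \<le> \<bar>r I\<bar>" by (simp add: g_def v mult.assoc)
  qed
  have "(\<Sum>I\<in>S. r I *\<^sub>R elem_tens (y I)) = (\<Sum>xs\<leftarrow>map g L. elem_tens xs)"
  proof -
    have "(\<Sum>xs\<leftarrow>map g L. elem_tens xs) = (\<Sum>I\<in>S. elem_tens (g I))"
      using L by (simp add: sum_list_distinct_conv_sum_set o_def)
    then show ?thesis by (simp add: g(1))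
  qed
  moreover have "\<forall>xs\<in>set (map g L). length xs = k" using L g(2) by auto
  ultimately have "proj_norm k (\<Sum>I\<in>S. r I *\<^sub>R elem_tens (y I)) \<le> (\<Sum>xs\<leftarrow>map g L. \<Prod>x\<leftarrow>xs. norm x)"
    unfolding proj_norm_def
  proof (intro cInf_lower)
    show "bdd_below {(\<Sum>xs\<leftarrow>xss. \<Prod>x\<leftarrow>xs. norm x) | xss. (\<forall>xs\<in>set xss. length xs = k)
        \<and> (\<Sum>I\<in>S. r I *\<^sub>R elem_tens (y I)) = (\<Sum>xs\<leftarrow>xss. elem_tens xs)}"
      by (intro bdd_belowI[of _ 0]) (auto intro!: sum_list_nonneg prod_list_nonneg)
  qed blast
  also have "\<dots> = (\<Sum>I\<in>S. prod_list (map norm (g I)))"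
    using L by (simp add: sum_list_distinct_conv_sum_set o_def)
  also have "\<dots> \<le> (\<Sum>I\<in>S. \<bar>r I\<bar>)" by (intro sum_mono g(3))
  finally show ?thesis .
qed

section \<open>Cones over the unit ball\<close>

text \<open>The scalar is absorbed by the first factor. For k = 0 the minimal power is a single
  nonzero point and not a cone.\<close>

lemma min_pow_scale:
  fixes C :: "'a::real_normed_vector set"
  assumes C: "\<And>r x. 0 \<le> r \<Longrightarrow> x \<in> C \<Longrightarrow> r *\<^sub>R x \<in> C"
    and k: "k \<ge> 1" and z: "z \<in> min_pow k C" and r: "0 \<le> r"
  shows "r *\<^sub>R z \<in> min_pow k C"
proof -
  have "r *\<^sub>R z \<in> (\<lambda>z. r *\<^sub>R z) ` min_pow k C" using z by blast
  also have "\<dots> = convex hull ((\<lambda>z. r *\<^sub>R z) ` elem_tens ` {xs. length xs = k \<and> set xs \<subseteq> C})"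
    unfolding min_pow_def by (rule convex_hull_scaling[symmetric])
  also have "\<dots> \<subseteq> min_pow k C"
    unfolding min_pow_def
  proof (rule hull_mono, safe)
    fix xs :: "'a list"
    assume xs: "set xs \<subseteq> C" "k = length xs"
    then obtain y ys where y: "xs = y # ys" using k by (cases xs) auto
    have "r *\<^sub>R elem_tens xs = elem_tens ((r *\<^sub>R y) # ys)"
      by (simp add: y elem_tens_Cons linear_scale[OF linear_tens_cons_left])
    moreover have "length ((r *\<^sub>R y) # ys) = length xs \<and> set ((r *\<^sub>R y) # ys) \<subseteq> C"
      using xs y r C by auto
    ultimately show "r *\<^sub>R elem_tens xs \<in> elem_tens ` {ys. length ys = length xs \<and> set ys \<subseteq> C}"
      by blast
  qed
  finally show ?thesis .
qed

lemma min_pow_add: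
  assumes C: "\<And>r x. 0 \<le> r \<Longrightarrow> x \<in> C \<Longrightarrow> r *\<^sub>R x \<in> C"
    and k: "k \<ge> 1" and z: "z \<in> min_pow k C" "w \<in> min_pow k C"
  shows "z + w \<in> min_pow k C"
proof -
  have "2 *\<^sub>R z \<in> min_pow k C" "2 *\<^sub>R w \<in> min_pow k C"
    using z by (auto intro!: min_pow_scale[OF C k])
  moreover have "convex (min_pow k C)" unfolding min_pow_def by (rule convex_convex_hull)
  ultimately have "(1/2) *\<^sub>R (2 *\<^sub>R z) + (1/2) *\<^sub>R (2 *\<^sub>R w) \<in> min_pow k C"
    by (intro convexD) auto
  then show ?thesis by simp
qed

lemma tens_map_min_pow:
  assumes "\<And>x. x \<in> C \<Longrightarrow> blinfun_apply f x \<in> D" "z \<in> min_pow k C"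
  shows "tens_map f z \<in> min_pow k D"
proof -
  have "tens_map f z \<in> tens_map f ` min_pow k C" using assms(2) by blast
  also have "\<dots> = convex hull (tens_map f ` elem_tens ` {xs. length xs = k \<and> set xs \<subseteq> C})"
    unfolding min_pow_def by (rule convex_hull_linear_image[OF linear_tens_map])
  also have "\<dots> \<subseteq> min_pow k D"
    unfolding min_pow_def using assms(1)
    by (intro hull_mono) (force simp: tens_map_elem_tens)
  finally show ?thesis .
qed

lemma tens_map_tens_pow:
  assumes "z \<in> tens_pow k"
  shows "tens_map f z \<in> tens_pow k"
proof -
  have "tens_map f z \<in> span (tens_map f ` elem_tens ` {xs. length xs = k})"
    using assms unfolding tens_pow_def linear_span_image[OF linear_tens_map] by blast
  also have "\<dots> \<subseteq> tens_pow k"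
    unfolding tens_pow_def by (intro span_mono) (auto simp: tens_map_elem_tens)
  finally show ?thesis .
qed

lemma tens_map_max_pow:
  assumes f: "\<And>x. x \<in> C \<Longrightarrow> blinfun_apply f x \<in> D" and z: "z \<in> max_pow k C"
  shows "tens_map f z \<in> max_pow k D"
proof -
  have comp: "\<psi> o\<^sub>L f \<in> dual_cone C" if "\<psi> \<in> dual_cone D" for \<psi>
    using that f by (auto simp: dual_cone_def)
  have "0 \<le> tens_app (tens_map f z) \<psi>s" if "length \<psi>s = k" "set \<psi>s \<subseteq> dual_cone D" for \<psi>s
  proof -
    have "set (map (\<lambda>\<psi>. \<psi> o\<^sub>L f) \<psi>s) \<subseteq> dual_cone C" using comp that(2) by auto
    moreover have "length (map (\<lambda>\<psi>. \<psi> o\<^sub>L f) \<psi>s) = k" using that(1) by simp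
    ultimately show ?thesis using z unfolding max_pow_def tens_map.rep_eq by blast
  qed
  then show ?thesis using z tens_map_tens_pow[of z k f] by (simp add: max_pow_def)
qed

lemma blinfun_compose_assoc: "(f o\<^sub>L g) o\<^sub>L h = f o\<^sub>L (g o\<^sub>L h)"
  by (rule blinfun_eqI) simp

lemma tens_map_comp: "tens_map f (tens_map g z) = tens_map (f o\<^sub>L g) z"
  by (rule tens_eqI) (simp add: tens_map.rep_eq o_def blinfun_compose_assoc)

lemma norm_cone_scale: "0 \<le> r \<Longrightarrow> x \<in> norm_cone \<Longrightarrow> r *\<^sub>R x \<in> norm_cone"
  by (auto simp: norm_cone_def mult_left_mono)

lemma e0_pow_Suc: "e0_pow (Suc k) = tens_cons e\<^sub>0 (e0_pow k)"
  by (simp add: e0_pow_def elem_tens_Cons)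

lemma tens_cons_min_pow: "x \<in> C \<Longrightarrow> z \<in> min_pow k C \<Longrightarrow> tens_cons x z \<in> min_pow (Suc k) C"
  unfolding min_pow_Suc by (intro hull_inc) blast

text \<open>Both signs are carried along: with \<open>E = e\<^sub>0\<^sup>\<otimes>\<^sup>k\<close> and \<open>Z\<close> the product of the tail,
  \<open>2 (e\<^sub>0 \<otimes> E \<plusminus> x \<otimes> Z) = (e\<^sub>0 + x) \<otimes> (E \<plusminus> Z) + (e\<^sub>0 - x) \<otimes> (E \<mp> Z)\<close>.\<close>

lemma e0_pow_plus_elem_in_min_pow:
  fixes xs :: "'a::real_normed_vector list"
  assumes "xs \<noteq> []" "\<forall>x\<in>set xs. norm x \<le> 1" "s = 1 \<or> s = -1"
  shows "e0_pow (length xs) + s *\<^sub>R elem_tens (map (blinfun_apply incl_X) xs)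
    \<in> min_pow (length xs) norm_cone"
  using assms
proof (induction xs arbitrary: s rule: list_nonempty_induct)
  case (single x)
  have "e0_pow 1 + s *\<^sub>R elem_tens [(0, x)] = elem_tens [(1, s *\<^sub>R x)]"
  proof -
    have "(1, s *\<^sub>R x) = e\<^sub>0 + s *\<^sub>R (0, x)" by (simp add: e\<^sub>0_def)
    then have "\<psi> (1, s *\<^sub>R x) = \<psi> e\<^sub>0 + s * \<psi> (0, x)" for \<psi> :: "(real \<times> 'a) \<Rightarrow>\<^sub>L real"
      by (simp only: blinfun.add_right blinfun.scaleR_right real_scaleR_def)
    then show ?thesis by (intro tens_eqI) (simp add: e0_pow_def elem_tens.rep_eq)
  qed
  moreover have "(1, s *\<^sub>R x) \<in> norm_cone" using single by (auto simp: norm_cone_def)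
  ultimately show ?case
    by (auto simp: incl_X_apply min_pow_def intro!: hull_inc)
next
  case (cons x xs)
  let ?k = "length xs" and ?Z = "elem_tens (map (blinfun_apply incl_X) xs)"
  have k: "?k \<ge> 1" using cons.hyps by (cases xs) auto
  have IH: "e0_pow ?k + r *\<^sub>R ?Z \<in> min_pow ?k norm_cone" if "r = 1 \<or> r = -1" for r
    using cons.IH cons.prems that by auto
  have x: "(1, x) \<in> norm_cone" "(1, - x) \<in> norm_cone" using cons.prems by (auto simp: norm_cone_def)
  have eq: "(1, x) = e\<^sub>0 + (0, x)" "(1, - x) = e\<^sub>0 - (0, x)" by (auto simp: e\<^sub>0_def)
  have "(1/2) *\<^sub>R tens_cons (1, x) (e0_pow ?k + s *\<^sub>R ?Z)
      + (1/2) *\<^sub>R tens_cons (1, - x) (e0_pow ?k + (- s) *\<^sub>R ?Z) \<in> min_pow (Suc ?k) norm_cone"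
    using cons.prems
    by (intro min_pow_add min_pow_scale tens_cons_min_pow x IH norm_cone_scale) auto
  also have "(1/2) *\<^sub>R tens_cons (1, x) (e0_pow ?k + s *\<^sub>R ?Z)
      + (1/2) *\<^sub>R tens_cons (1, - x) (e0_pow ?k + (- s) *\<^sub>R ?Z)
      = tens_cons e\<^sub>0 (e0_pow ?k) + s *\<^sub>R tens_cons (0, x) ?Z"
    unfolding eq
    by (rule tens_eqI)
       (simp add: tens_cons.rep_eq minus_tens.rep_eq blinfun.add_right blinfun.diff_right field_simps split: list.split)
  finally show ?case by (simp add: e0_pow_Suc elem_tens_Cons incl_X_apply[of x])
qed

lemma linear_tens_app_Cons:
  assumes "z \<in> tens_pow (Suc k)"
  shows "tens_app z ((\<phi> + \<psi>) # \<psi>s) = tens_app z (\<phi> # \<psi>s) + tens_app z (\<psi> # \<psi>s)"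
    "tens_app z ((\<phi> - \<psi>) # \<psi>s) = tens_app z (\<phi> # \<psi>s) - tens_app z (\<psi> # \<psi>s)"
  using tens_app_Cons[OF assms, of \<psi>s] by (auto simp: blinfun.add_left blinfun.diff_left)

lemma fst_pm_in_dual_norm_cone:
  assumes "norm (\<phi> :: 'a::real_normed_vector \<Rightarrow>\<^sub>L real) \<le> 1"
  shows "fst_blinfun + (\<phi> o\<^sub>L snd_blinfun) \<in> dual_cone norm_cone"
    "fst_blinfun - (\<phi> o\<^sub>L snd_blinfun) \<in> dual_cone norm_cone"
proof -
  have "0 \<le> t + \<phi> x \<and> 0 \<le> t - \<phi> x" if "norm x \<le> t" for x t
    using norm_blinfun[of \<phi> x] mult_right_mono[OF assms norm_ge_zero[of x]] that by auto
  then show "fst_blinfun + (\<phi> o\<^sub>L snd_blinfun) \<in> dual_cone norm_cone"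
    "fst_blinfun - (\<phi> o\<^sub>L snd_blinfun) \<in> dual_cone norm_cone"
    by (simp_all add: dual_cone_def norm_cone_def fst_blinfun.rep_eq snd_blinfun.rep_eq
        blinfun.add_left blinfun.diff_left)
qed

text \<open>On the maximal power the coefficient of \<open>e0_pow\<close> dominates the injective
  norm of the component in the power of X. The induction contracts the first slot with
  \<open>fst_blinfun\<close> plus and minus the functional, both of which are positive on the
  cone.\<close>

lemma max_pow_app_le:
  fixes z :: "(real \<times> 'a::real_normed_vector) tens"
  assumes "z \<in> max_pow (length \<phi>s) norm_cone" "\<forall>\<phi>\<in>set \<phi>s. norm \<phi> \<le> 1"
  shows "\<bar>tens_app z (map (\<lambda>\<phi>. \<phi> o\<^sub>L snd_blinfun) \<phi>s)\<bar> \<le> tens_app z (replicate (length \<phi>s) fst_blinfun)"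
  using assms
proof (induction \<phi>s arbitrary: z)
  case Nil
  then show ?case by (simp add: max_pow_def)
next
  case (Cons \<phi> \<phi>s)
  let ?F = "replicate (length \<phi>s) fst_blinfun" and ?G = "map (\<lambda>\<phi>. \<phi> o\<^sub>L snd_blinfun) \<phi>s"
  have z: "z \<in> tens_pow (Suc (length \<phi>s))" using Cons.prems by (simp add: max_pow_def)
  have "\<bar>tens_app z (\<psi> # ?G)\<bar> \<le> tens_app z (\<psi> # ?F)" if "\<psi> \<in> dual_cone norm_cone" for \<psi>
  proof -
    have "tens_contract \<psi> z \<in> max_pow (length \<phi>s) norm_cone"
      using Cons.prems(1) that z by (simp add: max_pow_def tens_contract_tens_pow tens_contract.rep_eq)
    from Cons.IH[OF this] Cons.prems(2) show ?thesis by (simp add: tens_contract.rep_eq)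
  qed
  from this[OF fst_pm_in_dual_norm_cone(1)] this[OF fst_pm_in_dual_norm_cone(2)] Cons.prems(2)
  have "\<bar>tens_app z ((fst_blinfun + (\<phi> o\<^sub>L snd_blinfun)) # ?G)\<bar>
      \<le> tens_app z ((fst_blinfun + (\<phi> o\<^sub>L snd_blinfun)) # ?F)"
    "\<bar>tens_app z ((fst_blinfun - (\<phi> o\<^sub>L snd_blinfun)) # ?G)\<bar>
      \<le> tens_app z ((fst_blinfun - (\<phi> o\<^sub>L snd_blinfun)) # ?F)" by auto
  \<comment> \<open>Twice the wanted value is the difference of the two expressions bounded above,
    while the two bounds add up to twice the right-hand side.\<close>
  then show ?case by (simp add: linear_tens_app_Cons[OF z])
qed

section \<open>The two inclusions of cones\<close>

context
  fixes P :: "'a::real_normed_vector \<Rightarrow>\<^sub>L 'a" and \<beta> :: real and k :: nat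
  assumes P: "inj_proj_bounded \<beta> P" and P_le: "\<And>v. norm (P v) \<le> \<beta> * norm v"
    and \<beta>: "0 \<le> \<beta>" and k: "k \<ge> 1"
begin

lemma scal_oplus_norm_cone:
  assumes "x \<in> norm_cone"
  shows "scal_oplus \<beta> P x \<in> norm_cone"
proof -
  obtain t v where x: "x = (t, v)" "norm v \<le> t" using assms by (auto simp: norm_cone_def)
  have "norm (P v) \<le> \<beta> * t" using P_le[of v] mult_left_mono[OF x(2) \<beta>] by linarith
  then show ?thesis by (simp add: x(1) norm_cone_def scal_oplus_apply)
qed

lemma tens_map_scal_oplus_e0_pow: "tens_map (scal_oplus \<beta> P) (e0_pow j) = \<beta> ^ j *\<^sub>R e0_pow j"
proof (induction j)
  case 0
  then show ?case by (simp add: e0_pow_def tens_map_elem_tens)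
next
  case (Suc j)
  have "scal_oplus \<beta> P e\<^sub>0 = \<beta> *\<^sub>R e\<^sub>0" by (simp add: e\<^sub>0_def scal_oplus_apply)
  moreover have "tens_map (scal_oplus \<beta> P) (e0_pow (Suc j))
      = tens_cons (scal_oplus \<beta> P e\<^sub>0) (tens_map (scal_oplus \<beta> P) (e0_pow j))"
    by (simp add: e0_pow_def tens_map_elem_tens flip: elem_tens_Cons)
  ultimately show ?case
    by (simp add: Suc e0_pow_Suc linear_scale[OF linear_tens_cons] linear_scale[OF linear_tens_cons_left])
qed

lemma tens_map_scal_oplus_incl:
  "tens_map (scal_oplus \<beta> P) (tens_map incl_X z) = tens_map incl_X (tens_map P z)"
proof -
  have "scal_oplus \<beta> P o\<^sub>L incl_X = incl_X o\<^sub>L P"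
    by (rule blinfun_eqI) (simp add: incl_X_apply scal_oplus_apply)
  then show ?thesis by (simp add: tens_map_comp)
qed

text \<open>Positivity settles \<open>min_pow\<close>. On \<open>cone_inj\<close> the image of the
  tensor part is expanded into signed elementary tensors, and each of them is paired with a share of
  \<open>e0_pow\<close> large enough to make it separable.\<close>

lemma tens_map_hat_pow_subset: "tens_map (scal_oplus \<beta> P) ` hat_pow k \<subseteq> min_pow k norm_cone"
proof -
  let ?Q = "tens_map (scal_oplus \<beta> P)"
  have "?Q z \<in> min_pow k norm_cone" if "z \<in> cone_inj k" for z
  proof -
    obtain t y where y: "z = t *\<^sub>R e0_pow k + tens_map incl_X y" "y \<in> tens_pow k" "inj_norm k y \<le> t"
      using \<open>z \<in> cone_inj k\<close> by (auto simp: cone_inj_def)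
    obtain S :: "nat list set" and r v where S: "finite S"
        "\<forall>I\<in>S. length (v I) = k \<and> (\<forall>x\<in>set (v I). norm x \<le> 1)"
        "tens_map P y = (\<Sum>I\<in>S. r I *\<^sub>R elem_tens (v I))" "(\<Sum>I\<in>S. \<bar>r I\<bar>) \<le> \<beta> ^ k * inj_norm k y"
      by (rule inj_proj_boundedE[OF P y(2)]) (rule that)
    let ?e = "e0_pow k :: (real \<times> 'a) tens"
    let ?w = "\<lambda>I. \<bar>r I\<bar> *\<^sub>R (?e + sgn (r I) *\<^sub>R elem_tens (map (blinfun_apply incl_X) (v I)))"
    \<comment> \<open>The share of \<open>e0_pow\<close> left after the summands have used theirs;
      the bound on the coefficients makes it nonnegative.\<close>
    define q where "q = \<beta> ^ k * t - (\<Sum>I\<in>S. \<bar>r I\<bar>)"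
    have q: "0 \<le> q"
      using S(4) mult_left_mono[OF y(3), of "\<beta> ^ k"] \<beta> by (simp add: q_def)
    have e: "?e \<in> min_pow k norm_cone"
      unfolding e0_pow_def min_pow_def by (intro hull_inc) (auto simp: norm_cone_def e\<^sub>0_def)
    have w: "?w I \<in> min_pow k norm_cone" if I: "I \<in> S" for I
    proof (cases "r I = 0")
      \<comment> \<open>Here \<open>sgn (r I)\<close> is 0 rather than a sign, so the lemma on
        signed elementary tensors does not apply; the summand itself vanishes.\<close>
      case True
      then show ?thesis using min_pow_scale[OF norm_cone_scale k e, of 0] by simp
    next
      case False
      have v: "length (v I) = k" "v I \<noteq> []" "\<forall>x\<in>set (v I). norm x \<le> 1"
        using bspec[OF S(2) I] k by auto
      from False have "sgn (r I) = 1 \<or> sgn (r I) = -1" by (auto simp: sgn_real_def)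
      then show ?thesis
        using v e0_pow_plus_elem_in_min_pow[of "v I" "sgn (r I)"]
        by (intro min_pow_scale norm_cone_scale k) auto
    qed
    have qe: "q *\<^sub>R ?e \<in> min_pow k norm_cone" using q k e by (intro min_pow_scale norm_cone_scale)
    have "q *\<^sub>R ?e + (\<Sum>I\<in>T. ?w I) \<in> min_pow k norm_cone" if "T \<subseteq> S" for T
      using finite_subset[OF that S(1)] that
    proof (induction T)
      case empty
      then show ?case using qe by simp
    next
      case (insert I T)
      then have "?w I + (q *\<^sub>R ?e + (\<Sum>I\<in>T. ?w I)) \<in> min_pow k norm_cone"
        by (intro min_pow_add[OF norm_cone_scale k w]) auto
      then show ?case using insert.hyps by (simp add: add_ac)
    qed
    from this[of S] have "q *\<^sub>R ?e + (\<Sum>I\<in>S. ?w I) \<in> min_pow k norm_cone" by simp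
    moreover have "(\<Sum>I\<in>S. ?w I) = (\<Sum>I\<in>S. \<bar>r I\<bar>) *\<^sub>R ?e + tens_map incl_X (tens_map P y)"
      unfolding S(3) linear_sum[OF linear_tens_map] linear_scale[OF linear_tens_map] tens_map_elem_tens
      by (simp add: scaleR_add_right sum.distrib scaleR_sum_left abs_mult_sgn)
    moreover have "?Q z = (\<beta> ^ k * t) *\<^sub>R ?e + tens_map incl_X (tens_map P y)"
      by (simp add: y(1) linear_add[OF linear_tens_map] linear_scale[OF linear_tens_map]
          tens_map_scal_oplus_e0_pow tens_map_scal_oplus_incl mult.commute)
    ultimately show ?thesis by (simp add: q_def algebra_simps)
  qed
  then have "?Q ` (min_pow k norm_cone \<union> cone_inj k) \<subseteq> min_pow k norm_cone"
    using tens_map_min_pow[OF scal_oplus_norm_cone] by auto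
  then show ?thesis
    unfolding hat_pow_def convex_hull_linear_image[OF linear_tens_map]
    by (intro hull_minimal) (simp_all add: min_pow_def)
qed

text \<open>Positivity gives membership in \<open>max_pow\<close>. The projection of the image only
  sees \<open>t\<close> and \<open>P\<close> applied to \<open>y\<close>; since
  \<open>inj_norm k y\<close> \<le> \<open>t\<close>, the passage from injective to projective norm
  yields the bound \<open>\<beta> ^ k * t\<close>.\<close>

lemma tens_map_max_pow_subset: "tens_map (scal_oplus \<beta> P) ` max_pow k norm_cone \<subseteq> check_pow k"
proof safe
  fix z :: "(real \<times> 'a) tens"
  let ?Q = "tens_map (scal_oplus \<beta> P)"
  assume z: "z \<in> max_pow k norm_cone"
  define t where "t = tens_app z (replicate k fst_blinfun)"
  define y where "y = tens_map snd_blinfun z"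
  have y: "y \<in> tens_pow k"
    unfolding y_def using z by (intro tens_map_tens_pow) (simp add: max_pow_def)
  have "inj_norm k y \<le> t"
    unfolding inj_norm_def
  proof (rule cSup_least)
    have "length (replicate k (0 :: 'a \<Rightarrow>\<^sub>L real)) = k \<and> (\<forall>\<phi>\<in>set (replicate k (0 :: 'a \<Rightarrow>\<^sub>L real)). norm \<phi> \<le> 1)"
      by simp
    then show "{\<bar>tens_app y \<phi>s\<bar> |\<phi>s. length \<phi>s = k \<and> (\<forall>\<phi>\<in>set \<phi>s. norm \<phi> \<le> 1)} \<noteq> {}" by blast
    fix m assume "m \<in> {\<bar>tens_app y \<phi>s\<bar> |\<phi>s. length \<phi>s = k \<and> (\<forall>\<phi>\<in>set \<phi>s. norm \<phi> \<le> 1)}"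
    then show "m \<le> t" using max_pow_app_le[of z] z by (auto simp: y_def t_def tens_map.rep_eq)
  qed
  then have yt: "\<beta> ^ k * inj_norm k y \<le> \<beta> ^ k * t" using \<beta> by (intro mult_left_mono) auto
  obtain S :: "nat list set" and r v where S: "finite S"
      "\<forall>I\<in>S. length (v I) = k \<and> (\<forall>x\<in>set (v I). norm x \<le> 1)"
      "tens_map P y = (\<Sum>I\<in>S. r I *\<^sub>R elem_tens (v I))" "(\<Sum>I\<in>S. \<bar>r I\<bar>) \<le> \<beta> ^ k * inj_norm k y"
    by (rule inj_proj_boundedE[OF P y]) (rule that)
  have pn: "proj_norm k (tens_map P y) \<le> \<beta> ^ k * t"
    using proj_norm_le[OF S(1) k S(2), of r] S(3,4) yt by simp
  have "fst_blinfun o\<^sub>L scal_oplus \<beta> P = \<beta> *\<^sub>R fst_blinfun"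
    by (rule blinfun_eqI) (auto simp: fst_blinfun.rep_eq scal_oplus_apply blinfun.scaleR_left)
  then have "tens_app (?Q z) (replicate k fst_blinfun) = tens_app z (replicate k (\<beta> *\<^sub>R fst_blinfun))"
    by (simp add: tens_map.rep_eq)
  also have "\<dots> = \<beta> ^ k * t"
  proof -
    \<comment> \<open>Elements of the type \<open>tens\<close> are arbitrary functions; homogeneity
      in each slot holds on the span of elementary tensors, and only there can the powers of \<beta>
      be pulled out.\<close>
    have "z \<in> span (elem_tens ` {xs. length xs = k})" using z by (simp add: max_pow_def tens_pow_def)
    then show ?thesis
      unfolding t_def
    proof (rule linear_eq_on[rotated 2, where f = "\<lambda>z. tens_app z (replicate k (\<beta> *\<^sub>R fst_blinfun))"
          and g = "\<lambda>z. \<beta> ^ k * tens_app z (replicate k fst_blinfun)"])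
      show "linear (\<lambda>z::(real \<times> 'a) tens. tens_app z (replicate k (\<beta> *\<^sub>R fst_blinfun)))"
        "linear (\<lambda>z::(real \<times> 'a) tens. \<beta> ^ k * tens_app z (replicate k fst_blinfun))"
        by (rule linearI; simp add: algebra_simps)+
      fix b :: "(real \<times> 'a) tens"
      assume "b \<in> elem_tens ` {xs. length xs = k}"
      then show "tens_app b (replicate k (\<beta> *\<^sub>R fst_blinfun)) = \<beta> ^ k * tens_app b (replicate k fst_blinfun)"
        by (auto simp: elem_tens.rep_eq blinfun.scaleR_left prod.distrib)
    qed
  qed
  finally have t': "tens_app (?Q z) (replicate k fst_blinfun) = \<beta> ^ k * t" .
  have "(incl_X o\<^sub>L snd_blinfun) o\<^sub>L scal_oplus \<beta> P = incl_X o\<^sub>L P o\<^sub>L snd_blinfun"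
    by (rule blinfun_eqI) (auto simp: snd_blinfun.rep_eq scal_oplus_apply)
  then have "tens_map (incl_X o\<^sub>L snd_blinfun) (?Q z) = tens_map incl_X (tens_map P y)"
    by (simp add: tens_map_comp y_def blinfun_compose_assoc)
  with t' have "proj_Xk k (?Q z) = (\<beta> ^ k * t) *\<^sub>R e0_pow k + tens_map incl_X (tens_map P y)"
    by (simp add: proj_Xk_def)
  then have "proj_Xk k (?Q z) \<in> cone_proj k"
    using pn tens_map_tens_pow[OF y] unfolding cone_proj_def by blast
  then show "?Q z \<in> check_pow k"
    using tens_map_max_pow[OF scal_oplus_norm_cone z] by (simp add: check_pow_def)
qed

end

section \<open>Trace obstruction to entanglement breaking\<close>

text \<open>The right-hand side is the trace in coordinates, which depends on the operator alone; so
  the left-hand side is the same for all decompositions of one operator.\<close>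

lemma trace_finite_rank:
  fixes f :: "'b \<Rightarrow> 'a::real_normed_vector \<Rightarrow>\<^sub>L real" and w :: "'i \<Rightarrow> 'a \<Rightarrow>\<^sub>L real"
  assumes E: "\<And>v. (\<Sum>b\<in>E. f b v *\<^sub>R e b) = v"
  shows "(\<Sum>i\<in>A. w i (x i)) = (\<Sum>b\<in>E. f b (\<Sum>i\<in>A. w i (e b) *\<^sub>R x i))"
proof -
  have "(\<Sum>i\<in>A. w i (x i)) = (\<Sum>i\<in>A. w i (\<Sum>b\<in>E. f b (x i) *\<^sub>R e b))" by (simp add: E)
  also have "\<dots> = (\<Sum>i\<in>A. \<Sum>b\<in>E. f b (x i) * w i (e b))"
    by (simp add: blinfun.sum_right blinfun.scaleR_right)
  also have "\<dots> = (\<Sum>b\<in>E. \<Sum>i\<in>A. f b (x i) * w i (e b))" by (rule sum.swap)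
  finally show ?thesis by (simp add: blinfun.sum_right blinfun.scaleR_right mult.commute)
qed

text \<open>A decomposition into positive rank-one maps would compute both \<beta>, from its scalar
  block, and the trace of \<open>P\<close>, from its X block; positivity bounds the second by the
  first, term by term.\<close>

lemma not_entanglement_breaking_if_trace:
  fixes P :: "'a::real_normed_vector \<Rightarrow>\<^sub>L 'a" and w :: "'i \<Rightarrow> 'a \<Rightarrow>\<^sub>L real" and e :: "'b \<Rightarrow> 'a"
  assumes E: "\<And>v. (\<Sum>b\<in>E. blinfun_apply (f b) v *\<^sub>R e b) = v"
    and P: "\<And>v. P v = (\<Sum>i\<in>A. w i v *\<^sub>R x i)" and tr: "\<beta> < (\<Sum>i\<in>A. w i (x i))"
  shows "\<not> entanglement_breaking norm_cone norm_cone (scal_oplus \<beta> P)"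
proof
  assume "entanglement_breaking norm_cone norm_cone (scal_oplus \<beta> P)"
  then obtain n :: nat and y \<phi> where *: "\<And>i. i < n \<Longrightarrow> y i \<in> norm_cone \<and> \<phi> i \<in> dual_cone norm_cone"
      "\<And>v. scal_oplus \<beta> P v = (\<Sum>i<n. \<phi> i v *\<^sub>R y i)"
    unfolding entanglement_breaking_def by blast
  define \<eta> where "\<eta> i = \<phi> i o\<^sub>L incl_X" for i
  have \<eta>: "\<eta> i v = \<phi> i (0, v)" for i v by (simp add: \<eta>_def incl_X_apply)
  have snd_eq: "P v = (\<Sum>i<n. \<eta> i v *\<^sub>R snd (y i))" for v
    using arg_cong[OF *(2)[of "(0, v)"], of snd] by (simp add: scal_oplus_apply snd_sum \<eta>)
  have fst_eq: "\<beta> = (\<Sum>i<n. \<phi> i (1, 0) * fst (y i))"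
    using arg_cong[OF *(2)[of "(1, 0)"], of fst] by (simp add: scal_oplus_apply fst_sum)
  have "(\<Sum>i\<in>A. w i (x i)) = (\<Sum>b\<in>E. f b (P (e b)))" unfolding P by (rule trace_finite_rank[OF E])
  also have "\<dots> = (\<Sum>i<n. \<eta> i (snd (y i)))"
    unfolding snd_eq by (rule trace_finite_rank[OF E, symmetric])
  also have "\<dots> \<le> (\<Sum>i<n. \<phi> i (1, 0) * fst (y i))"
  proof (rule sum_mono)
    fix i assume "i \<in> {..<n}"
    then have i: "y i \<in> norm_cone" "\<phi> i \<in> dual_cone norm_cone" using *(1) by auto
    \<comment> \<open>The cone is symmetric under reflection of X; testing the functional on the
      reflected vector bounds the X part from above.\<close>
    have "(fst (y i), - snd (y i)) \<in> norm_cone" using i(1) by (auto simp: norm_cone_def)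
    then have "0 \<le> \<phi> i (fst (y i), - snd (y i))" using i(2) by (auto simp: dual_cone_def)
    also have "(fst (y i), - snd (y i)) = fst (y i) *\<^sub>R (1, 0) - (0, snd (y i))" by simp
    finally show "\<eta> i (snd (y i)) \<le> \<phi> i (1, 0) * fst (y i)"
      by (simp only: \<eta> blinfun.diff_right blinfun.scaleR_right) (simp add: mult.commute)
  qed
  finally show False using tr fst_eq by simp
qed

section \<open>Nuclear norm and trace duality\<close>

definition rank_one :: "('a::real_normed_vector \<Rightarrow>\<^sub>L real) \<Rightarrow> 'b::real_normed_vector \<Rightarrow> 'a \<Rightarrow>\<^sub>L 'b" where
  "rank_one \<phi> x = blinfun_scaleR_left x o\<^sub>L \<phi>"

lemma rank_one_apply [simp]: "rank_one \<phi> x z = \<phi> z *\<^sub>R x"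
  by (simp add: rank_one_def)

text \<open>Nuclear norm with respect to the Euclidean norm on \<open>\<real>\<^sup>E\<close>, which the coordinate functionals \<open>f\<close>
  identify with the domain of \<open>u\<close>: a list of triples \<open>(c, x, a)\<close> stands for \<open>\<Sum> c \<sqdot> x \<otimes> a\<close>.\<close>

definition nuclear_rep ::
  "'b set \<Rightarrow> ('b \<Rightarrow> 'a::real_normed_vector \<Rightarrow>\<^sub>L real) \<Rightarrow> (real \<times> 'a \<times> ('b \<Rightarrow> real)) list \<Rightarrow> ('a \<Rightarrow>\<^sub>L 'a) \<Rightarrow> bool" where
  "nuclear_rep E f L u \<longleftrightarrow>
    (\<forall>(c, x, a)\<in>set L. 0 \<le> c \<and> norm x \<le> 1 \<and> (\<Sum>b\<in>E. (a b)\<^sup>2) \<le> 1) \<and>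
    u = (\<Sum>(c, x, a)\<leftarrow>L. \<Sum>b\<in>E. (c * a b) *\<^sub>R rank_one (f b) x)"

definition nuclear_norm ::
  "'b set \<Rightarrow> ('b \<Rightarrow> 'a::real_normed_vector \<Rightarrow>\<^sub>L real) \<Rightarrow> ('a \<Rightarrow>\<^sub>L 'a) \<Rightarrow> real" where
  "nuclear_norm E f u = Inf {sum_list (map fst L) | L. nuclear_rep E f L u}"

lemma nuclear_rep_nonneg: "nuclear_rep E f L u \<Longrightarrow> 0 \<le> sum_list (map fst L)"
  by (rule sum_list_nonneg) (force simp: nuclear_rep_def)

lemma nuclear_norm_le: "nuclear_rep E f L u \<Longrightarrow> nuclear_norm E f u \<le> sum_list (map fst L)"
  unfolding nuclear_norm_def
  by (intro cInf_lower bdd_belowI[of _ 0]) (auto dest: nuclear_rep_nonneg)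

text \<open>For x = 0 also \<open>sgn x\<close> is 0, an admissible vector of cost 0, so no case is
  lost.\<close>

lemma nuclear_rep_rank_one:
  assumes "(\<Sum>b\<in>E. (a b)\<^sup>2) \<le> 1"
  shows "nuclear_rep E f [(norm x, sgn x, a)] (\<Sum>b\<in>E. a b *\<^sub>R rank_one (f b) x)"
proof -
  have "(norm x * a b) *\<^sub>R rank_one (f b) (sgn x) = a b *\<^sub>R rank_one (f b) x" for b
    by (cases "x = 0"; rule blinfun_eqI) (simp_all add: blinfun.scaleR_left sgn_div_norm)
  then show ?thesis using assms by (simp add: nuclear_rep_def norm_sgn)
qed

lemma nuclear_rep_append:
  "nuclear_rep E f L u \<Longrightarrow> nuclear_rep E f M v \<Longrightarrow> nuclear_rep E f (L @ M) (u + v)"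
  by (auto simp: nuclear_rep_def)

lemma nuclear_rep_scale:
  assumes "nuclear_rep E f L u" "0 \<le> r"
  shows "nuclear_rep E f (map (\<lambda>(c, x, a). (r * c, x, a)) L) (r *\<^sub>R u)"
proof -
  have "r *\<^sub>R (\<Sum>(c, x, a)\<leftarrow>L. \<Sum>b\<in>E. (c * a b) *\<^sub>R rank_one (f b) x)
      = (\<Sum>(c, x, a)\<leftarrow>map (\<lambda>(c, x, a). (r * c, x, a)) L. \<Sum>b\<in>E. (c * a b) *\<^sub>R rank_one (f b) x)"
    by (induction L) (auto simp: scaleR_add_right scaleR_sum_right mult.assoc)
  then show ?thesis using assms by (auto simp: nuclear_rep_def)
qed

lemma nuclear_rep_sum:
  assumes "finite S" "\<And>i. i \<in> S \<Longrightarrow> \<exists>L. nuclear_rep E f L (u i)"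
  shows "\<exists>L. nuclear_rep E f L (\<Sum>i\<in>S. u i)"
  using assms
proof (induction S)
  case empty
  have "nuclear_rep E f [] 0" by (simp add: nuclear_rep_def)
  then show ?case by auto
next
  case (insert i S)
  then show ?case using nuclear_rep_append by fastforce
qed

text \<open>In use \<nu> is the nuclear norm of the identity. Its infimum is only approached, hence
  the slack \<delta> in the cost; the pairing with \<open>t\<close> is exactly \<nu> because it
  depends on the operator alone.\<close>

definition norms_identity ::
  "'b set \<Rightarrow> ('b \<Rightarrow> 'a::real_normed_vector \<Rightarrow>\<^sub>L real) \<Rightarrow> ('b \<Rightarrow> 'a \<Rightarrow>\<^sub>L real) \<Rightarrow> real \<Rightarrow> bool" where
  "norms_identity E f t \<nu> \<longleftrightarrow> (\<forall>\<delta>>0. \<exists>(n::nat) c x a.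
    (\<forall>i<n. 0 \<le> c i \<and> norm (x i) \<le> 1 \<and> (\<Sum>b\<in>E. (a i b)\<^sup>2) \<le> 1)
    \<and> (\<forall>z. (\<Sum>i<n. (c i * (\<Sum>b\<in>E. a i b * f b z)) *\<^sub>R x i) = z)
    \<and> (\<Sum>i<n. c i) < \<nu> + \<delta> \<and> (\<Sum>i<n. c i * (\<Sum>b\<in>E. a i b * t b (x i))) = \<nu>)"

context
  fixes E :: "'a::real_normed_vector set" and f :: "'a \<Rightarrow> 'a \<Rightarrow>\<^sub>L real"
  assumes fin: "finite E" and E: "\<And>v. (\<Sum>b\<in>E. f b v *\<^sub>R b) = v"
begin

lemma blinfun_expansion: "(u :: 'a \<Rightarrow>\<^sub>L 'a) = (\<Sum>b\<in>E. rank_one (f b) (u b))"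
proof (rule blinfun_eqI)
  fix z
  have "u z = u (\<Sum>b\<in>E. f b z *\<^sub>R b)" by (simp only: E)
  also have "\<dots> = (\<Sum>b\<in>E. f b z *\<^sub>R u b)" by (simp only: blinfun.sum_right blinfun.scaleR_right)
  finally show "u z = (\<Sum>b\<in>E. rank_one (f b) (u b)) z" by (simp add: blinfun.sum_left)
qed

lemma nuclear_rep_exists: "\<exists>L. nuclear_rep E f L u"
proof -
  have "\<exists>L. nuclear_rep E f L (rank_one (f b) (u b))" if b: "b \<in> E" for b
  proof -
    let ?a = "\<lambda>b'. if b' = b then 1 else 0 :: real"
    have "(\<Sum>b\<in>E. (?a b)\<^sup>2) \<le> 1" using fin b by (simp add: if_distrib[of "\<lambda>x. x\<^sup>2"] cong: if_cong)
    from nuclear_rep_rank_one[OF this, of f "u b"] show ?thesis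
      using fin b by (auto simp: if_distrib[of "\<lambda>x. x *\<^sub>R _"] cong: if_cong)
  qed
  then have "\<exists>L. nuclear_rep E f L (\<Sum>b\<in>E. rank_one (f b) (u b))" by (intro nuclear_rep_sum fin)
  then show ?thesis by (simp only: blinfun_expansion[of u, symmetric])
qed

lemma nuclear_norm_greatest:
  assumes "\<And>L. nuclear_rep E f L u \<Longrightarrow> m \<le> sum_list (map fst L)"
  shows "m \<le> nuclear_norm E f u"
  unfolding nuclear_norm_def using assms nuclear_rep_exists[of u] by (intro cInf_greatest) auto

lemma nuclear_norm_near:
  assumes "0 < \<delta>"
  obtains L where "nuclear_rep E f L u" "sum_list (map fst L) < nuclear_norm E f u + \<delta>"
proof (rule ccontr)
  assume "\<not> thesis"
  then have "nuclear_norm E f u + \<delta> \<le> sum_list (map fst L)" if "nuclear_rep E f L u" for L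
    using that \<open>\<And>L. \<lbrakk>nuclear_rep E f L u; sum_list (map fst L) < nuclear_norm E f u + \<delta>\<rbrakk> \<Longrightarrow> thesis\<close>
    by force
  then have "nuclear_norm E f u + \<delta> \<le> nuclear_norm E f u" by (rule nuclear_norm_greatest)
  then show False using assms by simp
qed

lemma sublinear_nuclear_norm: "sublinear (nuclear_norm E f)"
proof -
  have add: "nuclear_norm E f (u + v) \<le> nuclear_norm E f u + nuclear_norm E f v" for u v
  proof -
    have "nuclear_norm E f (u + v) - sum_list (map fst M) \<le> nuclear_norm E f u"
      if "nuclear_rep E f M v" for M
      using nuclear_norm_le[OF nuclear_rep_append[OF _ that]] by (intro nuclear_norm_greatest) force
    then have "nuclear_norm E f (u + v) - nuclear_norm E f u \<le> nuclear_norm E f v"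
      by (intro nuclear_norm_greatest) force
    then show ?thesis by simp
  qed
  have le: "nuclear_norm E f (r *\<^sub>R u) \<le> r * nuclear_norm E f u" if r: "0 < r" for r u
  proof -
    have "nuclear_norm E f (r *\<^sub>R u) / r \<le> nuclear_norm E f u"
    proof (rule nuclear_norm_greatest)
      fix L assume "nuclear_rep E f L u"
      from nuclear_norm_le[OF nuclear_rep_scale[OF this]] r
      have "nuclear_norm E f (r *\<^sub>R u) \<le> sum_list (map fst (map (\<lambda>(c, x, a). (r * c, x, a)) L))" by simp
      also have "\<dots> = r * sum_list (map fst L)" by (induction L) (auto simp: algebra_simps)
      finally show "nuclear_norm E f (r *\<^sub>R u) / r \<le> sum_list (map fst L)" using r by (simp add: field_simps)
    qed
    then show ?thesis using r by (simp add: field_simps)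
  qed
  have "nuclear_rep E f [] 0" by (simp add: nuclear_rep_def)
  then have "nuclear_norm E f 0 \<le> 0" using nuclear_norm_le by fastforce
  moreover have "0 \<le> nuclear_norm E f 0" by (intro nuclear_norm_greatest nuclear_rep_nonneg)
  ultimately have zero: "nuclear_norm E f 0 = 0" by simp
  have "nuclear_norm E f (r *\<^sub>R u) = r * nuclear_norm E f u" if "0 \<le> r" for r u
  proof (cases "r = 0")
    case False
    then have r: "r > 0" using that by simp
    have "nuclear_norm E f u \<le> (1/r) * nuclear_norm E f (r *\<^sub>R u)"
      using le[of "1/r" "r *\<^sub>R u"] r by simp
    then have "r * nuclear_norm E f u \<le> nuclear_norm E f (r *\<^sub>R u)" using r by (simp add: field_simps)
    then show ?thesis using le[OF r, of u] by simp
  qed (simp add: zero)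
  then show ?thesis using add by (simp add: sublinear_def)
qed

text \<open>Supplies the finite spanning set of the operator space on which the Hahn--Banach theorem
  is applied.\<close>

lemma span_rank_one: "span ((\<lambda>(b, b'). rank_one (f b) b') ` (E \<times> E)) = UNIV"
proof -
  have "u \<in> span ((\<lambda>(b, b'). rank_one (f b) b') ` (E \<times> E))" for u
  proof -
    have "rank_one (f b) (u b) = (\<Sum>b'\<in>E. f b' (u b) *\<^sub>R rank_one (f b) b')" for b
    proof (rule blinfun_eqI)
      fix z
      have "rank_one (f b) (u b) z = f b z *\<^sub>R (\<Sum>b'\<in>E. f b' (u b) *\<^sub>R b')" by (simp add: E)
      also have "\<dots> = (\<Sum>b'\<in>E. f b' (u b) *\<^sub>R rank_one (f b) b') z"
        by (simp add: blinfun.sum_left blinfun.scaleR_left scaleR_sum_right mult.commute)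
      finally show "rank_one (f b) (u b) z = (\<Sum>b'\<in>E. f b' (u b) *\<^sub>R rank_one (f b) b') z" .
    qed
    then have "u = (\<Sum>b\<in>E. \<Sum>b'\<in>E. f b' (u b) *\<^sub>R rank_one (f b) b')"
      by (intro trans[OF blinfun_expansion[of u]]) simp
    also have "\<dots> \<in> span ((\<lambda>(b, b'). rank_one (f b) b') ` (E \<times> E))"
      by (intro span_sum span_scale span_base) auto
    finally show ?thesis .
  qed
  then show ?thesis by auto
qed

text \<open>The Hahn--Banach functional \<open>F\<close> dual to the identity yields \<open>T : X \<rightarrow> \<real>\<^sup>E\<close>, \<open>T x = (t b x)\<^sub>b\<close>, of norm
  at most one; it norms every nearly optimal nuclear decomposition of the identity.\<close>

lemma nuclear_duality:
  obtains \<nu> and t :: "'a \<Rightarrow> 'a \<Rightarrow>\<^sub>L real" where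
    "\<And>x. (\<Sum>b\<in>E. (t b x)\<^sup>2) \<le> (norm x)\<^sup>2"
    "norms_identity E f t \<nu>"
proof -
  let ?p = "nuclear_norm E f" and ?I = "id_blinfun :: 'a \<Rightarrow>\<^sub>L 'a"
  have "finite ((\<lambda>(b, b'). rank_one (f b) b') ` (E \<times> E))" using fin by simp
  from Hahn_Banach_finite_dim[OF sublinear_nuclear_norm this span_rank_one, of ?I]
  obtain F where F: "linear F" "\<And>u. F u \<le> ?p u" "F ?I = ?p ?I" by blast
  define T where "T b x = F (rank_one (f b) x)" for b x
  have F_sum: "F (\<Sum>b\<in>E. r b *\<^sub>R rank_one (f b) x) = (\<Sum>b\<in>E. r b * T b x)" for r x
    by (simp add: linear_sum[OF F(1)] linear_scale[OF F(1)] T_def)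
  have le: "(\<Sum>b\<in>E. a b * T b x) \<le> norm x" if "(\<Sum>b\<in>E. (a b)\<^sup>2) \<le> 1" for a x
    using F(2)[of "\<Sum>b\<in>E. a b *\<^sub>R rank_one (f b) x"] nuclear_norm_le[OF nuclear_rep_rank_one[OF that, of f x]]
    by (simp add: F_sum)
  have T2: "(\<Sum>b\<in>E. (T b x)\<^sup>2) \<le> (norm x)\<^sup>2" for x
  proof -
    define N where "N = sqrt (\<Sum>b\<in>E. (T b x)\<^sup>2)"
    have N2: "N\<^sup>2 = (\<Sum>b\<in>E. (T b x)\<^sup>2)" by (simp add: N_def sum_nonneg)
    have N0: "0 \<le> N" by (simp add: N_def sum_nonneg)
    show ?thesis
    proof (cases "N = 0")
      case True
      then show ?thesis using N2 by simp
    next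
      case False
      \<comment> \<open>Testing \<open>le\<close> with the normalized image of \<open>x\<close>
        itself turns it into a bound on the Euclidean length \<open>N\<close>.\<close>
      have "(\<Sum>b\<in>E. (T b x / N)\<^sup>2) = (\<Sum>b\<in>E. (T b x)\<^sup>2) / N\<^sup>2"
        by (simp add: power_divide sum_divide_distrib)
      then have "(\<Sum>b\<in>E. (T b x / N)\<^sup>2) \<le> 1" using False by (simp flip: N2)
      from le[OF this, of x] have "(\<Sum>b\<in>E. T b x / N * T b x) \<le> norm x" .
      moreover have "(\<Sum>b\<in>E. T b x / N * T b x) = (\<Sum>b\<in>E. (T b x)\<^sup>2) / N"
        by (simp add: sum_divide_distrib power2_eq_square)
      then have "(\<Sum>b\<in>E. T b x / N * T b x) = N\<^sup>2 / N" by (simp only: N2)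
      ultimately have "N \<le> norm x" using False by (simp add: power2_eq_square)
      then show ?thesis unfolding N2[symmetric] using N0 by (rule power_mono)
    qed
  qed
  have bl: "bounded_linear (T b)" if b: "b \<in> E" for b
  proof (rule bounded_linear_intro)
    have "rank_one (f b) (x + y) = rank_one (f b) x + rank_one (f b) y" for x y :: 'a
      by (rule blinfun_eqI) (simp add: blinfun.add_left scaleR_add_right)
    then show "T b (x + y) = T b x + T b y" for x y by (simp add: T_def linear_add[OF F(1)])
    have "rank_one (f b) (r *\<^sub>R x) = r *\<^sub>R rank_one (f b) x" for r and x :: 'a
      by (rule blinfun_eqI) (simp add: blinfun.scaleR_left mult.commute)
    then show "T b (r *\<^sub>R x) = r *\<^sub>R T b x" for r x by (simp add: T_def linear_scale[OF F(1)])
    show "norm (T b x) \<le> norm x * 1" for x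
    proof -
      have "(T b x)\<^sup>2 \<le> (\<Sum>b\<in>E. (T b x)\<^sup>2)" using fin b by (intro member_le_sum) auto
      then have "(T b x)\<^sup>2 \<le> (norm x)\<^sup>2" using T2[of x] by simp
      then show ?thesis by (simp add: abs_le_square_iff[symmetric])
    qed
  qed
  \<comment> \<open>Boundedness of \<open>T b\<close> has been shown for \<open>b\<close> in
    \<open>E\<close> only, so \<open>t b\<close> is identified with \<open>T b\<close> only
    there.\<close>
  define t where "t b = Blinfun (T b)" for b
  have t: "t b x = T b x" if "b \<in> E" for b x
    using bl[OF that] by (simp add: t_def bounded_linear_Blinfun_apply)
  show ?thesis
  proof (rule that)
    show "(\<Sum>b\<in>E. (t b x)\<^sup>2) \<le> (norm x)\<^sup>2" for x using T2[of x] by (simp add: t)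
    show "norms_identity E f t (?p ?I)"
      unfolding norms_identity_def
    proof (intro allI impI)
      fix \<delta> :: real assume "0 < \<delta>"
      then obtain L where L: "nuclear_rep E f L ?I" "sum_list (map fst L) < ?p ?I + \<delta>"
        by (rule nuclear_norm_near)
      define c where "c i = fst (L ! i)" for i
      define x where "x i = fst (snd (L ! i))" for i
      define a where "a i = snd (snd (L ! i))" for i
      have nth: "L ! i = (c i, x i, a i)" for i by (simp add: c_def x_def a_def)
      have sums: "sum_list (map g L) = (\<Sum>i<length L. g (c i, x i, a i))" for g :: "_ \<Rightarrow> 'v::comm_monoid_add"
        by (simp add: sum_list_sum_nth atLeast0LessThan nth)
      have I: "?I = (\<Sum>i<length L. \<Sum>b\<in>E. (c i * a i b) *\<^sub>R rank_one (f b) (x i))"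
        using L(1) by (simp add: nuclear_rep_def sums)
      have "0 \<le> c i \<and> norm (x i) \<le> 1 \<and> (\<Sum>b\<in>E. (a i b)\<^sup>2) \<le> 1" if "i < length L" for i
        using L(1) nth_mem[OF that] by (auto simp: nuclear_rep_def nth)
      moreover have "(\<Sum>i<length L. (c i * (\<Sum>b\<in>E. a i b * f b z)) *\<^sub>R x i) = z" for z
      proof -
        have "z = ?I z" by simp
        also have "\<dots> = (\<Sum>i<length L. (c i * (\<Sum>b\<in>E. a i b * f b z)) *\<^sub>R x i)"
          unfolding I by (simp add: blinfun.sum_left blinfun.scaleR_left sum_distrib_left scaleR_sum_left mult.assoc)
        finally show ?thesis by simp
      qed
      moreover have "(\<Sum>i<length L. c i) < ?p ?I + \<delta>" using L(2) by (simp add: sums)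
      moreover have "(\<Sum>i<length L. c i * (\<Sum>b\<in>E. a i b * t b (x i))) = ?p ?I"
      proof -
        have "?p ?I = F (\<Sum>i<length L. \<Sum>b\<in>E. (c i * a i b) *\<^sub>R rank_one (f b) (x i))"
          using F(3) I by simp
        also have "\<dots> = (\<Sum>i<length L. \<Sum>b\<in>E. (c i * a i b) * T b (x i))"
          by (simp only: linear_sum[OF F(1)] linear_scale[OF F(1)] T_def real_scaleR_def)
        finally show ?thesis by (simp add: t sum_distrib_left mult.assoc)
      qed
      ultimately show "\<exists>(n::nat) c x a. (\<forall>i<n. 0 \<le> c i \<and> norm (x i) \<le> 1 \<and> (\<Sum>b\<in>E. (a i b)\<^sup>2) \<le> 1)
        \<and> (\<forall>z. (\<Sum>i<n. (c i * (\<Sum>b\<in>E. a i b * f b z)) *\<^sub>R x i) = z)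
        \<and> (\<Sum>i<n. c i) < ?p ?I + \<delta> \<and> (\<Sum>i<n. c i * (\<Sum>b\<in>E. a i b * t b (x i))) = ?p ?I"
        by (intro exI[of _ "length L"] exI[of _ c] exI[of _ x] exI[of _ a]) simp
    qed
  qed
qed

end

section \<open>Perturbation in non-Euclidean spaces\<close>

lemma sum_mult_le_sqrt:
  "(\<Sum>i\<in>A. u i * v i) \<le> sqrt (\<Sum>i\<in>A. (u i)\<^sup>2) * sqrt (\<Sum>i\<in>A. (v i)\<^sup>2)" for u :: "'i \<Rightarrow> real"
  using real_le_rsqrt[OF Cauchy_Schwarz_ineq_sum[of u v A]] by (simp add: real_sqrt_mult)

text \<open>Since \<open>a i\<close> and \<open>\<tau> i\<close> lie in the unit ball, the weighted
  mean square of their differences is at most 2 (S - \<nu>), which is small for a nearly optimal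
  decomposition. Cauchy--Schwarz transfers this to the averages weighted by \<eta>. Later
  \<open>\<tau> i\<close> is the image of \<open>x i\<close> under T.\<close>

lemma decomposition_error:
  fixes c :: "nat \<Rightarrow> real" and a \<tau> :: "nat \<Rightarrow> 'b \<Rightarrow> real" and g :: "'b \<Rightarrow> real"
  assumes c: "\<And>i. i < n \<Longrightarrow> 0 \<le> c i" and a: "\<And>i. i < n \<Longrightarrow> (\<Sum>b\<in>E. (a i b)\<^sup>2) \<le> 1"
    and \<tau>: "\<And>i. i < n \<Longrightarrow> (\<Sum>b\<in>E. (\<tau> i b)\<^sup>2) \<le> 1"
    and \<eta>: "\<And>i. \<eta> i = (\<Sum>b\<in>E. a i b * g b)"
    and S: "S = (\<Sum>i<n. c i)" and \<nu>: "\<nu> = (\<Sum>i<n. c i * (\<Sum>b\<in>E. a i b * \<tau> i b))"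
  shows "(\<Sum>i<n. c i * (\<eta> i)\<^sup>2) \<le> S * (\<Sum>b\<in>E. (g b)\<^sup>2)"
    and "(\<Sum>b\<in>E. ((\<Sum>i<n. c i * \<eta> i * a i b) - (\<Sum>i<n. c i * \<eta> i * \<tau> i b))\<^sup>2)
      \<le> (\<Sum>b\<in>E. (g b)\<^sup>2) * (2 * S * (S - \<nu>))"
    and "\<nu> \<le> S"
proof -
  let ?G = "\<Sum>b\<in>E. (g b)\<^sup>2"
  have G: "0 \<le> ?G" by (intro sum_nonneg) auto
  have S0: "0 \<le> S" unfolding S using c by (intro sum_nonneg) auto
  have "(\<eta> i)\<^sup>2 \<le> 1 * ?G" if "i < n" for i
    unfolding \<eta> using a[OF that] G
    by (intro order_trans[OF Cauchy_Schwarz_ineq_sum] mult_right_mono) auto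
  then have "(\<Sum>i<n. c i * (\<eta> i)\<^sup>2) \<le> (\<Sum>i<n. c i * ?G)"
    using c by (intro sum_mono mult_left_mono) auto
  then show 1: "(\<Sum>i<n. c i * (\<eta> i)\<^sup>2) \<le> S * ?G" by (simp add: S sum_distrib_right)
  have d: "(\<Sum>b\<in>E. (a i b - \<tau> i b)\<^sup>2) \<le> 2 - 2 * (\<Sum>b\<in>E. a i b * \<tau> i b)" if "i < n" for i
    using a[OF that] \<tau>[OF that]
    by (simp add: power2_diff sum.distrib sum_subtractf sum_distrib_left mult.assoc)
  have "(\<Sum>b\<in>E. ((\<Sum>i<n. c i * \<eta> i * a i b) - (\<Sum>i<n. c i * \<eta> i * \<tau> i b))\<^sup>2)
      = (\<Sum>b\<in>E. (\<Sum>i<n. c i * \<eta> i * (a i b - \<tau> i b))\<^sup>2)"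
    by (simp add: sum_subtractf right_diff_distrib)
  also have "\<dots> \<le> (\<Sum>b\<in>E. (\<Sum>i<n. c i * (\<eta> i)\<^sup>2) * (\<Sum>i<n. c i * (a i b - \<tau> i b)\<^sup>2))"
    using c by (intro sum_mono weighted_Cauchy_Schwarz) auto
  also have "\<dots> = (\<Sum>i<n. c i * (\<eta> i)\<^sup>2) * (\<Sum>i<n. c i * (\<Sum>b\<in>E. (a i b - \<tau> i b)\<^sup>2))"
    unfolding sum_distrib_left[symmetric] by (subst sum.swap) (simp add: sum_distrib_left)
  also have "\<dots> \<le> (S * ?G) * (\<Sum>i<n. c i * (2 - 2 * (\<Sum>b\<in>E. a i b * \<tau> i b)))"
    using c S0 G by (intro mult_mono 1 sum_mono mult_left_mono d sum_nonneg mult_nonneg_nonneg) auto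
  also have "(\<Sum>i<n. c i * (2 - 2 * (\<Sum>b\<in>E. a i b * \<tau> i b))) = 2 * (S - \<nu>)"
    by (simp add: S \<nu> right_diff_distrib sum_subtractf sum_distrib_left mult_ac)
  finally show "(\<Sum>b\<in>E. ((\<Sum>i<n. c i * \<eta> i * a i b) - (\<Sum>i<n. c i * \<eta> i * \<tau> i b))\<^sup>2)
      \<le> ?G * (2 * S * (S - \<nu>))" by (simp add: mult_ac)
  have "(\<Sum>b\<in>E. a i b * \<tau> i b) \<le> 1" if "i < n" for i
  proof -
    have "0 \<le> (\<Sum>b\<in>E. (a i b - \<tau> i b)\<^sup>2)" by (intro sum_nonneg) auto
    then show ?thesis using d[OF that] by linarith
  qed
  then have "\<nu> \<le> (\<Sum>i<n. c i * 1)"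
    unfolding \<nu> using c by (intro sum_mono mult_left_mono) auto
  then show "\<nu> \<le> S" by (simp add: S)
qed

text \<open>The last hypothesis says that the functional z \<mapsto> <Tz, Th> has norm at least r =
  |Th|. A nearly norming unit vector u has |Tu| \<le> 1 and <Tu, Th> close to r, so r Tu is close to
  Th; by the lower bound on T, r u is close to h. Hence the norm of h is at most r, and T is an
  isometry.\<close>

lemma euclidean_if_tangent:
  fixes t :: "'b \<Rightarrow> 'a::real_normed_vector \<Rightarrow>\<^sub>L real"
  assumes T: "\<And>x. (\<Sum>b\<in>E. (t b x)\<^sup>2) \<le> (norm x)\<^sup>2"
    and C: "\<And>x. norm x \<le> C * sqrt (\<Sum>b\<in>E. (t b x)\<^sup>2)"
    and ex: "\<And>h \<kappa>. 0 < \<kappa> \<Longrightarrow> \<kappa> < sqrt (\<Sum>b\<in>E. (t b h)\<^sup>2) \<Longrightarrow> \<exists>z. \<kappa> * norm z < (\<Sum>b\<in>E. t b z * t b h)"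
  shows "euclidean_norm (norm :: 'a \<Rightarrow> real)"
proof -
  define Q where "Q x y = (\<Sum>b\<in>E. t b x * t b y)" for x y
  have QQ: "Q x x = (\<Sum>b\<in>E. (t b x)\<^sup>2)" for x by (simp add: Q_def power2_eq_square)
  have Q0: "0 \<le> Q x x" for x unfolding QQ by (intro sum_nonneg) auto
  have pos: "0 < Q x x" if "x \<noteq> 0" for x
  proof (rule ccontr)
    assume "\<not> 0 < Q x x"
    then have "Q x x = 0" using Q0[of x] by simp
    then show False using C[of x] that by (simp add: QQ)
  qed
  have lin: "linear (\<lambda>x. Q x y)" "linear (Q y)" for y
    by (rule linearI; simp add: Q_def blinfun.add_right blinfun.scaleR_right algebra_simps
        sum.distrib sum_distrib_left)+
  have inner: "is_inner_product Q"
    unfolding is_inner_product_def bilinear_def using lin pos by (auto simp: Q_def mult.commute)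
  have "norm h = sqrt (Q h h)" for h
  proof (cases "h = 0")
    case True
    then show ?thesis by (simp add: Q_def)
  next
    case False
    define r where "r = sqrt (Q h h)"
    have r: "0 < r" using pos[OF False] by (simp add: r_def)
    have r2: "Q h h = r\<^sup>2" using Q0[of h] by (simp add: r_def)
    have bound: "norm h \<le> r + C * sqrt (2 * r * (r - \<kappa>))" if \<kappa>: "0 < \<kappa>" "\<kappa> < r" for \<kappa>
    proof -
      obtain z where z: "\<kappa> * norm z < Q z h"
        using ex[of \<kappa> h] \<kappa> by (auto simp: r_def QQ Q_def)
      have "z \<noteq> 0" using z by (auto simp: Q_def)
      then have nz: "0 < norm z" by simp
      define u where "u = (1 / norm z) *\<^sub>R z"
      have u: "norm u = 1" using nz by (simp add: u_def)
      have "Q u h = Q z h / norm z" using linear_scale[OF lin(1)[of h]] by (simp add: u_def)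
      then have uh: "\<kappa> < Q u h" using z nz by (simp add: pos_less_divide_eq)
      have uu: "Q u u \<le> 1" using T[of u] u by (simp add: QQ)
      define w where "w = h - r *\<^sub>R u"
      have "Q w w = Q h h - 2 * r * Q u h + r\<^sup>2 * Q u u"
        by (simp add: w_def Q_def blinfun.diff_right blinfun.scaleR_right algebra_simps
            sum.distrib sum_subtractf sum_distrib_left power2_eq_square)
      also have "\<dots> \<le> r\<^sup>2 - 2 * r * \<kappa> + r\<^sup>2 * 1"
        using r uh uu by (intro add_mono diff_mono mult_left_mono) (auto simp: r2)
      also have "\<dots> = 2 * r * (r - \<kappa>)" by (simp add: power2_eq_square algebra_simps)
      finally have w: "sqrt (Q w w) \<le> sqrt (2 * r * (r - \<kappa>))" by simp
      have "0 \<le> C"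
        using C[of h] False pos[OF False] by (simp add: QQ[symmetric]) (smt (verit) mult_nonneg_nonpos2 norm_le_zero_iff real_sqrt_gt_zero mult_neg_pos)
      then have "norm w \<le> C * sqrt (2 * r * (r - \<kappa>))"
        using C[of w] mult_left_mono[OF w, of C] by (simp add: QQ)
      moreover have "norm h \<le> norm (r *\<^sub>R u) + norm w"
        using norm_triangle_ineq[of "r *\<^sub>R u" w] by (simp add: w_def)
      ultimately show ?thesis using r u by simp
    qed
    \<comment> \<open>Letting \<kappa> increase to \<open>r\<close> replaces the choice of an exact
      maximizer.\<close>
    have "((\<lambda>\<kappa>. r + C * sqrt (2 * r * (r - \<kappa>))) \<longlongrightarrow> r + C * sqrt (2 * r * (r - r))) (at_left r)"
      by (intro tendsto_intros)
    moreover have "eventually (\<lambda>\<kappa>. norm h \<le> r + C * sqrt (2 * r * (r - \<kappa>))) (at_left r)"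
      using eventually_at_left_real[OF r] by eventually_elim (auto intro: bound)
    ultimately have "norm h \<le> r + C * sqrt (2 * r * (r - r))"
      by (intro tendsto_lowerbound) auto
    moreover have "r\<^sup>2 \<le> (norm h)\<^sup>2" using T[of h] by (simp add: QQ flip: r2)
    then have "r \<le> norm h" by (rule power2_le_imp_le) simp
    ultimately show ?thesis by (simp add: r_def)
  qed
  then show ?thesis using inner by (auto simp: euclidean_norm_def)
qed

context
  fixes E :: "'a::real_normed_vector set" and f t :: "'a \<Rightarrow> 'a \<Rightarrow>\<^sub>L real" and \<nu> :: real
  assumes fin: "finite E" and E: "\<And>v. (\<Sum>b\<in>E. f b v *\<^sub>R b) = v"
    and T: "\<And>x. (\<Sum>b\<in>E. (t b x)\<^sup>2) \<le> (norm x)\<^sup>2"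
    and near: "norms_identity E f t \<nu>"
begin

text \<open>Combines \<open>norms_identity\<close> with \<open>decomposition_error\<close>: because
  the decomposition reproduces \<open>h\<close>, the average of the images T \<open>x i\<close> with
  weights \<open>c i * \<eta> h i\<close> is exactly T h, so the corresponding average of the
  \<open>a i\<close> is close to T h.\<close>

lemma near_optimal:
  assumes "0 < \<delta>"
  obtains n :: nat and c x a \<eta> S where
    "\<And>i. i < n \<Longrightarrow> 0 \<le> c i" "\<And>i. i < n \<Longrightarrow> norm (x i) \<le> 1" "\<And>i. i < n \<Longrightarrow> (\<Sum>b\<in>E. (a i b)\<^sup>2) \<le> 1"
    "\<And>h i. \<eta> h i = (\<Sum>b\<in>E. a i b * f b h)" "\<And>h. (\<Sum>i<n. (c i * \<eta> h i) *\<^sub>R x i) = h"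
    "S = (\<Sum>i<n. c i)" "\<nu> \<le> S" "S < \<nu> + \<delta>" "\<nu> = (\<Sum>i<n. c i * (\<Sum>b\<in>E. a i b * t b (x i)))"
    "\<And>h. (\<Sum>i<n. c i * (\<eta> h i)\<^sup>2) \<le> S * (\<Sum>b\<in>E. (f b h)\<^sup>2)"
    "\<And>h. (\<Sum>b\<in>E. ((\<Sum>i<n. c i * \<eta> h i * a i b) - t b h)\<^sup>2) \<le> (\<Sum>b\<in>E. (f b h)\<^sup>2) * (2 * S * (S - \<nu>))"
proof -
  from near[unfolded norms_identity_def, rule_format, OF assms] obtain n :: nat and c x a where
    *: "\<And>i. i < n \<Longrightarrow> 0 \<le> c i" "\<And>i. i < n \<Longrightarrow> norm (x i) \<le> 1" "\<And>i. i < n \<Longrightarrow> (\<Sum>b\<in>E. (a i b)\<^sup>2) \<le> 1"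
    "\<And>z. (\<Sum>i<n. (c i * (\<Sum>b\<in>E. a i b * f b z)) *\<^sub>R x i) = z"
    "(\<Sum>i<n. c i) < \<nu> + \<delta>" "\<nu> = (\<Sum>i<n. c i * (\<Sum>b\<in>E. a i b * t b (x i)))"
    by blast
  define \<eta> where "\<eta> h i = (\<Sum>b\<in>E. a i b * f b h)" for h i
  define S where "S = (\<Sum>i<n. c i)"
  have \<tau>: "(\<Sum>b\<in>E. (t b (x i))\<^sup>2) \<le> 1" if "i < n" for i
    using T[of "x i"] *(2)[OF that] by (smt (verit) norm_ge_zero power_le_one)
  have th: "(\<Sum>i<n. c i * \<eta> h i * t b (x i)) = t b h" for h b
  proof -
    have "t b h = t b (\<Sum>i<n. (c i * \<eta> h i) *\<^sub>R x i)" by (simp only: \<eta>_def *(4))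
    then show ?thesis by (simp add: blinfun.sum_right blinfun.scaleR_right)
  qed
  note err = decomposition_error[where g = "\<lambda>b. f b h" and \<eta> = "\<eta> h" for h, OF *(1,3) \<tau> \<eta>_def S_def *(6)]
  show ?thesis
    using that[OF *(1-3) \<eta>_def *(4)[folded \<eta>_def] S_def err(3) *(5)[folded S_def] *(6) err(1) err(2)[unfolded th]]
    by blast
qed

text \<open>By Cauchy--Schwarz the squared norm of h is at most S times the second moment of \<eta>,
  which is nearly the coordinate pairing <h, Th>. In the limit it is at most \<nu> |h| |Th|; as |h|
  is at most K times the norm of h, one factor of the norm cancels. The same inequality forces \<nu>
  > 0 if h is nonzero.\<close>

lemma norm_le_image:
  obtains C where "\<And>h. norm h \<le> C * sqrt (\<Sum>b\<in>E. (t b h)\<^sup>2)" "\<forall>h::'a. h \<noteq> 0 \<longrightarrow> 0 < \<nu>"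
proof -
  define K where "K = sqrt (\<Sum>b\<in>E. (norm (f b))\<^sup>2)"
  have K: "sqrt (\<Sum>b\<in>E. (f b h)\<^sup>2) \<le> K * norm h" for h
  proof -
    have "(f b h)\<^sup>2 \<le> (norm (f b))\<^sup>2 * (norm h)\<^sup>2" for b
      using power_mono[OF norm_blinfun[of "f b" h], of 2] by (simp add: power_mult_distrib)
    then have "(\<Sum>b\<in>E. (f b h)\<^sup>2) \<le> (\<Sum>b\<in>E. (norm (f b))\<^sup>2) * (norm h)\<^sup>2"
      by (simp add: sum_distrib_right sum_mono)
    then have "sqrt (\<Sum>b\<in>E. (f b h)\<^sup>2) \<le> sqrt ((\<Sum>b\<in>E. (norm (f b))\<^sup>2) * (norm h)\<^sup>2)" by simp
    then show ?thesis by (simp add: K_def real_sqrt_mult)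
  qed
  have key: "(norm h)\<^sup>2 \<le> \<nu> * (sqrt (\<Sum>b\<in>E. (f b h)\<^sup>2) * sqrt (\<Sum>b\<in>E. (t b h)\<^sup>2))" for h
  proof -
    define A where "A = sqrt (\<Sum>b\<in>E. (f b h)\<^sup>2)"
    define B where "B = sqrt (\<Sum>b\<in>E. (t b h)\<^sup>2)"
    have A0: "0 \<le> A" "A\<^sup>2 = (\<Sum>b\<in>E. (f b h)\<^sup>2)" by (simp_all add: A_def sum_nonneg)
    have B0: "0 \<le> B" by (simp add: B_def sum_nonneg)
    have bound: "(norm h)\<^sup>2 \<le> (\<nu> + \<delta>) * (A * B + A * sqrt (A\<^sup>2 * (2 * (\<nu> + \<delta>) * \<delta>)))" if \<delta>: "0 < \<delta>" for \<delta>
    proof -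
      obtain n :: nat and c x a \<eta> S where
        *: "\<And>i. i < n \<Longrightarrow> 0 \<le> c i" "\<And>i. i < n \<Longrightarrow> norm (x i) \<le> 1" "\<And>i. i < n \<Longrightarrow> (\<Sum>b\<in>E. (a i b)\<^sup>2) \<le> 1"
        "\<And>h i. \<eta> h i = (\<Sum>b\<in>E. a i b * f b h)" "\<And>h. (\<Sum>i<n. (c i * \<eta> h i) *\<^sub>R x i) = h"
        "S = (\<Sum>i<n. c i)" "\<nu> \<le> S" "S < \<nu> + \<delta>" "\<nu> = (\<Sum>i<n. c i * (\<Sum>b\<in>E. a i b * t b (x i)))"
        "\<And>h. (\<Sum>i<n. c i * (\<eta> h i)\<^sup>2) \<le> S * (\<Sum>b\<in>E. (f b h)\<^sup>2)"
        "\<And>h. (\<Sum>b\<in>E. ((\<Sum>i<n. c i * \<eta> h i * a i b) - t b h)\<^sup>2) \<le> (\<Sum>b\<in>E. (f b h)\<^sup>2) * (2 * S * (S - \<nu>))"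
        using near_optimal[OF \<delta>] by blast
      define e where "e b = (\<Sum>i<n. c i * \<eta> h i * a i b) - t b h" for b
      have S0: "0 \<le> S" unfolding *(6) using *(1) by (intro sum_nonneg) auto
      have "norm h \<le> (\<Sum>i<n. c i * \<bar>\<eta> h i\<bar>)"
      proof -
        have "norm h = norm (\<Sum>i<n. (c i * \<eta> h i) *\<^sub>R x i)" by (simp only: *(5))
        also have "\<dots> \<le> (\<Sum>i<n. norm ((c i * \<eta> h i) *\<^sub>R x i))" by (rule norm_sum)
        also have "\<dots> \<le> (\<Sum>i<n. c i * \<bar>\<eta> h i\<bar>)"
        proof (rule sum_mono)
          fix i assume "i \<in> {..<n}"
          then have i: "0 \<le> c i" "norm (x i) \<le> 1" using * by auto
          have "norm ((c i * \<eta> h i) *\<^sub>R x i) = (c i * \<bar>\<eta> h i\<bar>) * norm (x i)" using i(1) by (simp add: abs_mult)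
          also have "\<dots> \<le> (c i * \<bar>\<eta> h i\<bar>) * 1" using i by (intro mult_left_mono) auto
          finally show "norm ((c i * \<eta> h i) *\<^sub>R x i) \<le> c i * \<bar>\<eta> h i\<bar>" by simp
        qed
        finally show ?thesis .
      qed
      then have "(norm h)\<^sup>2 \<le> (\<Sum>i<n. c i * \<bar>\<eta> h i\<bar>)\<^sup>2" by (intro power_mono) auto
      also have "\<dots> \<le> S * (\<Sum>i<n. c i * (\<eta> h i)\<^sup>2)"
        using weighted_Cauchy_Schwarz[of "{..<n}" c "\<lambda>_. 1" "\<lambda>i. \<bar>\<eta> h i\<bar>"] *(1) by (simp add: *(6))
      also have "(\<Sum>i<n. c i * (\<eta> h i)\<^sup>2) = (\<Sum>b\<in>E. f b h * t b h) + (\<Sum>b\<in>E. f b h * e b)"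
      proof -
        have "(\<Sum>i<n. c i * (\<eta> h i)\<^sup>2) = (\<Sum>i<n. \<Sum>b\<in>E. f b h * (c i * \<eta> h i * a i b))"
        proof (rule sum.cong)
          fix i
          have "c i * (\<eta> h i)\<^sup>2 = c i * \<eta> h i * (\<Sum>b\<in>E. a i b * f b h)" by (simp add: power2_eq_square *(4))
          then show "c i * (\<eta> h i)\<^sup>2 = (\<Sum>b\<in>E. f b h * (c i * \<eta> h i * a i b))"
            by (simp add: sum_distrib_left mult_ac)
        qed simp
        also have "\<dots> = (\<Sum>b\<in>E. f b h * (\<Sum>i<n. c i * \<eta> h i * a i b))"
          by (subst sum.swap) (simp add: sum_distrib_left)
        also have "\<dots> = (\<Sum>b\<in>E. f b h * (t b h + e b))" by (simp add: e_def)
        finally show ?thesis by (simp add: distrib_left sum.distrib)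
      qed
      also have "S * \<dots> \<le> S * (A * B + A * sqrt (\<Sum>b\<in>E. (e b)\<^sup>2))"
        unfolding A_def B_def using S0 by (intro mult_left_mono add_mono sum_mult_le_sqrt) auto
      also have "\<dots> \<le> (\<nu> + \<delta>) * (A * B + A * sqrt (A\<^sup>2 * (2 * (\<nu> + \<delta>) * \<delta>)))"
      proof -
        have "(\<Sum>b\<in>E. (e b)\<^sup>2) \<le> A\<^sup>2 * (2 * S * (S - \<nu>))" using *(11)[of h] by (simp add: e_def A0)
        also have "\<dots> \<le> A\<^sup>2 * (2 * (\<nu> + \<delta>) * \<delta>)"
          using *(7,8) S0 by (intro mult_left_mono mult_mono) auto
        finally have "sqrt (\<Sum>b\<in>E. (e b)\<^sup>2) \<le> sqrt (A\<^sup>2 * (2 * (\<nu> + \<delta>) * \<delta>))" by simp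
        then have "A * B + A * sqrt (\<Sum>b\<in>E. (e b)\<^sup>2) \<le> A * B + A * sqrt (A\<^sup>2 * (2 * (\<nu> + \<delta>) * \<delta>))"
          using A0(1) by (intro add_left_mono mult_left_mono)
        moreover have "0 \<le> A * B + A * sqrt (\<Sum>b\<in>E. (e b)\<^sup>2)"
          using A0(1) B0 by (intro add_nonneg_nonneg mult_nonneg_nonneg real_sqrt_ge_zero sum_nonneg) auto
        moreover have "0 \<le> \<nu> + \<delta>" using *(8) S0 by simp
        ultimately show ?thesis using *(8) by (intro mult_mono) simp_all
      qed
      finally show ?thesis .
    qed
    have "((\<lambda>\<delta>. (\<nu> + \<delta>) * (A * B + A * sqrt (A\<^sup>2 * (2 * (\<nu> + \<delta>) * \<delta>))))
        \<longlongrightarrow> (\<nu> + 0) * (A * B + A * sqrt (A\<^sup>2 * (2 * (\<nu> + 0) * 0)))) (at_right 0)"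
      by (intro tendsto_intros)
    moreover have "eventually (\<lambda>\<delta>. (norm h)\<^sup>2 \<le> (\<nu> + \<delta>) * (A * B + A * sqrt (A\<^sup>2 * (2 * (\<nu> + \<delta>) * \<delta>)))) (at_right 0)"
      using eventually_at_right_less[of "0::real"] by eventually_elim (rule bound)
    ultimately have "(norm h)\<^sup>2 \<le> (\<nu> + 0) * (A * B + A * sqrt (A\<^sup>2 * (2 * (\<nu> + 0) * 0)))"
      by (intro tendsto_lowerbound) auto
    then show ?thesis by (simp add: A_def B_def)
  qed
  have pos: "0 < \<nu>" if "h \<noteq> 0" for h :: 'a
  proof (rule ccontr)
    assume "\<not> 0 < \<nu>"
    then have "\<nu> * (sqrt (\<Sum>b\<in>E. (f b h)\<^sup>2) * sqrt (\<Sum>b\<in>E. (t b h)\<^sup>2)) \<le> 0"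
      by (intro mult_nonpos_nonneg mult_nonneg_nonneg real_sqrt_ge_zero sum_nonneg) auto
    then show False using key[of h] that by (smt (verit) norm_eq_zero zero_less_power2)
  qed
  have "norm h \<le> (\<nu> * K) * sqrt (\<Sum>b\<in>E. (t b h)\<^sup>2)" for h
  proof (cases "h = 0")
    case False
    have "(norm h)\<^sup>2 \<le> \<nu> * (sqrt (\<Sum>b\<in>E. (f b h)\<^sup>2) * sqrt (\<Sum>b\<in>E. (t b h)\<^sup>2))" by (rule key)
    also have "\<dots> \<le> \<nu> * ((K * norm h) * sqrt (\<Sum>b\<in>E. (t b h)\<^sup>2))"
      using pos[OF False] K[of h] by (intro mult_left_mono mult_right_mono real_sqrt_ge_zero sum_nonneg) auto
    finally have "norm h * norm h \<le> norm h * ((\<nu> * K) * sqrt (\<Sum>b\<in>E. (t b h)\<^sup>2))"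
      by (simp add: power2_eq_square mult_ac)
    then show ?thesis using False by simp
  qed simp
  then show ?thesis using pos by (intro that) auto
qed

text \<open>At S = \<nu> the trace is 1 + s (g - 1) with g > 1, whereas the majorizing quadratic
  form has total weight at most 1 + s^2 H: the first-order terms (1 - s)^2 + 2 s (1 - s) add up to 1
  - s^2. A small s gains, and continuity in S absorbs the error of a nearly optimal
  decomposition.\<close>

lemma exists_two_summing_large_trace:
  assumes noneucl: "\<not> euclidean_norm (norm :: 'a \<Rightarrow> real)"
  obtains n m :: nat and c d :: "nat \<Rightarrow> real" and x :: "nat \<Rightarrow> 'a" and w \<mu> :: "nat \<Rightarrow> 'a \<Rightarrow>\<^sub>L real" and \<beta> :: real
  where "\<And>i. i < n \<Longrightarrow> 0 \<le> c i" "(\<Sum>i<n. c i) \<le> 1" "\<And>i. i < n \<Longrightarrow> norm (x i) \<le> 1"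
    "\<And>j. j < m \<Longrightarrow> 0 \<le> d j" "(\<Sum>j<m. d j) \<le> \<beta>\<^sup>2" "0 \<le> \<beta>" "\<And>j. j < m \<Longrightarrow> norm (\<mu> j) \<le> 1"
    "\<And>v. (\<Sum>i<n. c i * (w i v)\<^sup>2) \<le> (\<Sum>j<m. d j * (\<mu> j v)\<^sup>2)"
    "\<beta> < (\<Sum>i<n. c i * w i (x i))"
proof -
  obtain C where C: "\<And>h. norm h \<le> C * sqrt (\<Sum>b\<in>E. (t b h)\<^sup>2)" and pos: "\<forall>h::'a. h \<noteq> 0 \<longrightarrow> 0 < \<nu>"
    by (rule norm_le_image) (rule that)
  obtain h0 \<kappa> where \<kappa>: "0 < \<kappa>" "\<kappa> < sqrt (\<Sum>b\<in>E. (t b h0)\<^sup>2)"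
      and tang: "\<And>z. (\<Sum>b\<in>E. t b z * t b h0) \<le> \<kappa> * norm z"
    using euclidean_if_tangent[OF T C] noneucl by (meson not_le)
  have "h0 \<noteq> 0" using \<kappa> by auto
  then have \<nu>: "0 < \<nu>" using pos by blast
  \<comment> \<open>With this scaling \<open>ell\<close> is the pairing with T h0 divided by
    \<kappa>, of norm at most 1 by \<open>tang\<close>, and \<open>ell h\<close> is \<nu> times
    \<open>g\<close>.\<close>
  define h where "h = (\<nu> / \<kappa>) *\<^sub>R h0"
  define q where "q b = t b h / \<nu>" for b
  define ell where "ell = (\<Sum>b\<in>E. q b *\<^sub>R t b)"
  define g where "g = (\<Sum>b\<in>E. (q b)\<^sup>2)"
  define H where "H = (\<Sum>b\<in>E. (f b h)\<^sup>2)"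
  have H0: "0 \<le> H" by (simp add: H_def sum_nonneg)
  have q: "q b = t b h0 / \<kappa>" for b using \<nu> by (simp add: q_def h_def blinfun.scaleR_right)
  have th: "t b h = \<nu> * q b" for b using \<nu> by (simp add: q_def)
  have ell: "ell z = (\<Sum>b\<in>E. q b * t b z)" for z by (simp add: ell_def blinfun.sum_left blinfun.scaleR_left)
  have "\<kappa>\<^sup>2 < (sqrt (\<Sum>b\<in>E. (t b h0)\<^sup>2))\<^sup>2" using \<kappa> by (intro power_strict_mono) auto
  then have "\<kappa>\<^sup>2 < (\<Sum>b\<in>E. (t b h0)\<^sup>2)" by (simp add: sum_nonneg)
  moreover have "g = (\<Sum>b\<in>E. (t b h0)\<^sup>2) / \<kappa>\<^sup>2"
    by (simp add: g_def q power_divide sum_divide_distrib)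
  ultimately have g: "1 < g" using \<kappa>(1) by (simp add: pos_less_divide_eq)
  have ell_le: "ell z \<le> norm z" for z
  proof -
    have "ell z = (\<Sum>b\<in>E. t b z * t b h0) / \<kappa>" by (simp add: ell q sum_divide_distrib mult.commute)
    then show ?thesis using tang[of z] \<kappa>(1) by (simp add: pos_divide_le_eq mult.commute)
  qed
  have norm_ell: "norm ell \<le> 1"
  proof (rule norm_blinfun_bound)
    show "norm (ell z) \<le> 1 * norm z" for z
      using ell_le[of z] ell_le[of "- z"] by (simp add: blinfun.minus_right abs_le_iff)
  qed simp
  have ellh: "ell h = \<nu> * g" by (simp add: ell g_def th sum_distrib_left power2_eq_square mult_ac)
  have comb: "\<bar>(\<Sum>b\<in>E. r b * t b z)\<bar> \<le> norm z" if r: "(\<Sum>b\<in>E. (r b)\<^sup>2) \<le> 1" for r z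
  proof -
    have "(\<Sum>b\<in>E. r b * t b z)\<^sup>2 \<le> 1 * (norm z)\<^sup>2"
      using r T[of z] by (intro order_trans[OF Cauchy_Schwarz_ineq_sum] mult_mono) (auto intro: sum_nonneg)
    then show ?thesis by (simp add: abs_le_square_iff[symmetric])
  qed
  have norm_comb: "norm (\<Sum>b\<in>E. r b *\<^sub>R t b) \<le> 1" if "(\<Sum>b\<in>E. (r b)\<^sup>2) \<le> 1" for r
    using comb[OF that] by (intro norm_blinfun_bound) (auto simp: blinfun.sum_left blinfun.scaleR_left)

  \<comment> \<open>The second bound gives s H \<le> g - 1, so the quadratic loss stays below the
    linear gain; adding 1 to \<open>H\<close> avoids division by zero, and 1/2 keeps 1 - s
    positive.\<close>
  define s where "s = min (1/2) ((g - 1) / (H + 1))"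
  have s: "0 < s" "s \<le> 1/2" "s \<le> (g - 1) / (H + 1)"
    unfolding s_def using g H0 by (simp, intro min.cobounded1, intro min.cobounded2)
  have sH: "s * H \<le> g - 1"
  proof -
    have "s * H \<le> s * (H + 1)" using s by simp
    also have "\<dots> \<le> g - 1" using s(3) H0 by (simp add: pos_le_divide_eq)
    finally show ?thesis .
  qed
  \<comment> \<open>\<open>\<rho> S\<close> will bound the relative error and vanishes at S = \<nu>;
    \<open>B S\<close> will be the square of \<beta>, and \<open>R S\<close> the trace.\<close>
  define \<rho> where "\<rho> S = sqrt (H * (2 * S * (S - \<nu>))) / S" for S
  define B where "B S = 1 + s\<^sup>2 * H + 2 * s * \<rho> S" for S
  define R where "R S = \<nu> / S * (1 + s * (g - 1))" for S
  have "s\<^sup>2 * H = s * (s * H)" by (simp add: power2_eq_square)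
  also have "\<dots> \<le> s * (g - 1)" using sH s(1) by (intro mult_left_mono) auto
  also have "\<dots> < 2 * (s * (g - 1)) + (s * (g - 1))\<^sup>2" using s(1) g by (simp add: add_pos_pos)
  finally have "1 + s\<^sup>2 * H < (1 + s * (g - 1))\<^sup>2" by (simp add: power2_sum)
  then have "0 < (R \<nu>)\<^sup>2 - B \<nu>" using \<nu> by (simp add: R_def B_def \<rho>_def)
  moreover have "((\<lambda>S. (R S)\<^sup>2 - B S) \<longlongrightarrow> (R \<nu>)\<^sup>2 - B \<nu>) (nhds \<nu>)"
    unfolding R_def B_def \<rho>_def using \<nu> by (intro tendsto_intros filterlim_ident) auto
  ultimately have "eventually (\<lambda>S. 0 < (R S)\<^sup>2 - B S) (nhds \<nu>)" by (rule order_tendstoD(1)[rotated])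
  then obtain \<delta> where \<delta>: "0 < \<delta>" "\<And>S. dist S \<nu> < \<delta> \<Longrightarrow> 0 < (R S)\<^sup>2 - B S"
    unfolding eventually_nhds_metric by blast

  obtain n :: nat and c x a \<eta> S where
    *: "\<And>i. i < n \<Longrightarrow> 0 \<le> c i" "\<And>i. i < n \<Longrightarrow> norm (x i) \<le> 1" "\<And>i. i < n \<Longrightarrow> (\<Sum>b\<in>E. (a i b)\<^sup>2) \<le> 1"
    "\<And>h i. \<eta> h i = (\<Sum>b\<in>E. a i b * f b h)" "\<And>h. (\<Sum>i<n. (c i * \<eta> h i) *\<^sub>R x i) = h"
    "S = (\<Sum>i<n. c i)" "\<nu> \<le> S" "S < \<nu> + \<delta>" "\<nu> = (\<Sum>i<n. c i * (\<Sum>b\<in>E. a i b * t b (x i)))"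
    "\<And>h. (\<Sum>i<n. c i * (\<eta> h i)\<^sup>2) \<le> S * (\<Sum>b\<in>E. (f b h)\<^sup>2)"
    "\<And>h. (\<Sum>b\<in>E. ((\<Sum>i<n. c i * \<eta> h i * a i b) - t b h)\<^sup>2) \<le> (\<Sum>b\<in>E. (f b h)\<^sup>2) * (2 * S * (S - \<nu>))"
    using near_optimal[OF \<delta>(1)] by blast
  have S: "0 < S" using *(7) \<nu> by simp
  have RB: "B S < (R S)\<^sup>2" using \<delta>(2)[of S] *(7,8) by (simp add: dist_real_def)
  define \<phi> where "\<phi> i = (\<Sum>b\<in>E. a i b *\<^sub>R t b)" for i
  have \<phi>: "\<phi> i z = (\<Sum>b\<in>E. a i b * t b z)" for i z by (simp add: \<phi>_def blinfun.sum_left blinfun.scaleR_left)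
  define e where "e b = (\<Sum>i<n. c i * \<eta> h i * a i b) - t b h" for b
  define \<epsilon> where "\<epsilon> = sqrt (\<Sum>b\<in>E. (e b)\<^sup>2)"
  define \<psi> where "\<psi> = (\<Sum>b\<in>E. (e b / \<epsilon>) *\<^sub>R t b)"
  have \<epsilon>0: "0 \<le> \<epsilon>" "\<epsilon>\<^sup>2 = (\<Sum>b\<in>E. (e b)\<^sup>2)" by (simp_all add: \<epsilon>_def sum_nonneg)
  have \<epsilon>\<rho>: "\<epsilon> / S \<le> \<rho> S"
    unfolding \<epsilon>_def \<rho>_def using *(11)[of h] S by (intro divide_right_mono real_sqrt_le_mono) (auto simp: e_def H_def)
  have "(\<Sum>b\<in>E. (e b / \<epsilon>)\<^sup>2) = (\<Sum>b\<in>E. (e b)\<^sup>2) / \<epsilon>\<^sup>2"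
    by (simp add: power_divide sum_divide_distrib)
  then have "(\<Sum>b\<in>E. (e b / \<epsilon>)\<^sup>2) \<le> 1" by (simp flip: \<epsilon>0(2))
  then have norm_\<psi>: "norm \<psi> \<le> 1" unfolding \<psi>_def by (rule norm_comb)
  \<comment> \<open>If \<epsilon> = 0, then \<open>e\<close> vanishes on \<open>E\<close>, so
    division by zero in \<psi> does no harm.\<close>
  have e_eq: "e b = \<epsilon> * (e b / \<epsilon>)" if "b \<in> E" for b
  proof (cases "\<epsilon> = 0")
    case True
    then have "(\<Sum>b\<in>E. (e b)\<^sup>2) = 0" using \<epsilon>0(2) by simp
    then have "e b = 0" using fin that by (simp add: sum_nonneg_eq_0_iff)
    then show ?thesis by simp
  qed simp
  have \<psi>: "\<epsilon> * \<psi> z = (\<Sum>b\<in>E. e b * t b z)" for z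
  proof -
    have "\<epsilon> * \<psi> z = (\<Sum>b\<in>E. \<epsilon> * (e b / \<epsilon>) * t b z)"
      by (cases "\<epsilon> = 0") (simp_all add: \<psi>_def blinfun.sum_left blinfun.scaleR_left sum_distrib_left mult.assoc)
    also have "\<dots> = (\<Sum>b\<in>E. e b * t b z)" using e_eq by (intro sum.cong) auto
    finally show ?thesis .
  qed
  \<comment> \<open>The average of the \<open>a i\<close> equals T h plus the error
    \<open>e\<close>; pairing with T z gives the main term \<nu> \<open>ell z\<close> and the error
    term.\<close>
  have cross: "(\<Sum>i<n. c i * \<eta> h i * \<phi> i z) = \<nu> * ell z + \<epsilon> * \<psi> z" for z
  proof -
    have "(\<Sum>i<n. c i * \<eta> h i * \<phi> i z) = (\<Sum>i<n. \<Sum>b\<in>E. (c i * \<eta> h i * a i b) * t b z)"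
      by (simp add: \<phi> sum_distrib_left mult.assoc)
    also have "\<dots> = (\<Sum>b\<in>E. (\<Sum>i<n. c i * \<eta> h i * a i b) * t b z)"
      by (subst sum.swap) (simp add: sum_distrib_right)
    also have "\<dots> = (\<Sum>b\<in>E. (\<nu> * q b + e b) * t b z)" by (simp add: e_def th)
    also have "\<dots> = \<nu> * ell z + \<epsilon> * \<psi> z"
      by (simp add: ell \<psi> distrib_right sum.distrib sum_distrib_left mult.assoc)
    finally show ?thesis .
  qed

  define w where "w i = (1 - s) *\<^sub>R \<phi> i + (s * \<eta> h i) *\<^sub>R ell" for i
  have w: "w i z = (1 - s) * \<phi> i z + s * \<eta> h i * ell z" for i z
    by (simp add: w_def blinfun.add_left blinfun.scaleR_left)
  \<comment> \<open>Expanding the square of \<open>w i\<close> leaves (1 - s)^2 on the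
    \<open>\<phi> j\<close>. By \<open>cross\<close> the mixed term gives 2 s (1 - s) \<nu> / S on
    \<open>ell\<close> plus an error product of \<open>ell\<close> and \<psi>, split evenly between
    indices n and \<open>Suc n\<close> by the arithmetic-geometric mean inequality; s^2 H comes from
    the second moment of \<eta>.\<close>
  define d where "d j = (if j < n then (1 - s)\<^sup>2 * (c j / S)
      else if j = n then 2 * s * (1 - s) * (\<nu> / S) + s * (1 - s) * (\<epsilon> / S) + s\<^sup>2 * H
      else s * (1 - s) * (\<epsilon> / S))" for j
  define \<mu> where "\<mu> j = (if j < n then \<phi> j else if j = n then ell else \<psi>)" for j
  have split: "(\<Sum>j<Suc (Suc n). F j) = (\<Sum>j<n. F j) + F n + F (Suc n)" for F :: "nat \<Rightarrow> real"
    by simp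
  have ss: "0 \<le> s * (1 - s)" using s by simp
  show ?thesis
  proof (rule that[of n "\<lambda>i. c i / S" x "Suc (Suc n)" d "sqrt (B S)" \<mu> w])
    show "0 \<le> c i / S" if "i < n" for i using *(1)[OF that] S by simp
    show "(\<Sum>i<n. c i / S) \<le> 1" using S by (simp add: sum_divide_distrib[symmetric] *(6)[symmetric])
    show "norm (x i) \<le> 1" if "i < n" for i by (rule *(2)[OF that])
    show "0 \<le> d j" if "j < Suc (Suc n)" for j
      using *(1) S s ss H0 \<nu> \<epsilon>0(1) by (auto simp: d_def)
    have "0 \<le> \<rho> S" using \<epsilon>\<rho> \<epsilon>0(1) S by (meson divide_nonneg_pos order_trans)
    then have B0: "0 \<le> B S" unfolding B_def using s H0 by simp
    then show "0 \<le> sqrt (B S)" by simp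
    show "norm (\<mu> j) \<le> 1" if "j < Suc (Suc n)" for j
      using norm_comb *(3) norm_ell norm_\<psi> by (simp add: \<mu>_def \<phi>_def)
    have "(\<Sum>j<n. d j) = (\<Sum>j<n. (1 - s)\<^sup>2 * (c j / S))" by (intro sum.cong) (auto simp: d_def)
    also have "\<dots> = (1 - s)\<^sup>2 * ((\<Sum>j<n. c j) / S)" by (simp add: sum_distrib_left sum_divide_distrib)
    finally have dn: "(\<Sum>j<n. d j) = (1 - s)\<^sup>2" using S by (simp add: *(6)[symmetric])
    have "(\<Sum>j<Suc (Suc n). d j) = (1 - s)\<^sup>2 + 2 * (s * (1 - s)) * (\<nu> / S) + 2 * ((s * (1 - s)) * (\<epsilon> / S)) + s\<^sup>2 * H"
      unfolding split dn by (simp add: d_def mult_ac)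
    also have "\<dots> \<le> (1 - s)\<^sup>2 + 2 * (s * (1 - s)) * 1 + 2 * (s * \<rho> S) + s\<^sup>2 * H"
    proof -
      have "s * (1 - s) \<le> s" using s by (simp add: algebra_simps)
      then have "s * (1 - s) * (\<epsilon> / S) \<le> s * \<rho> S" using \<epsilon>\<rho> \<epsilon>0(1) S s by (intro mult_mono) auto
      moreover have "2 * (s * (1 - s)) * (\<nu> / S) \<le> 2 * (s * (1 - s)) * 1"
        using *(7) S ss by (intro mult_left_mono) auto
      ultimately show ?thesis by linarith
    qed
    also have "\<dots> = B S - s\<^sup>2" by (simp add: B_def power2_eq_square algebra_simps)
    also have "\<dots> \<le> B S" by simp
    finally show "(\<Sum>j<Suc (Suc n). d j) \<le> (sqrt (B S))\<^sup>2" using B0 by simp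
    show "(\<Sum>i<n. c i / S * (w i z)\<^sup>2) \<le> (\<Sum>j<Suc (Suc n). d j * (\<mu> j z)\<^sup>2)" for z
    proof -
      have "c i / S * (w i z)\<^sup>2 = (1 - s)\<^sup>2 * (c i / S) * (\<phi> i z)\<^sup>2
          + 2 * (s * (1 - s)) * (ell z / S) * (c i * \<eta> h i * \<phi> i z)
          + s\<^sup>2 * ((ell z)\<^sup>2 / S) * (c i * (\<eta> h i)\<^sup>2)" for i
        by (simp add: w power2_eq_square algebra_simps)
      then have "(\<Sum>i<n. c i / S * (w i z)\<^sup>2) = (\<Sum>i<n. (1 - s)\<^sup>2 * (c i / S) * (\<phi> i z)\<^sup>2)
          + 2 * (s * (1 - s)) * (ell z / S) * (\<Sum>i<n. c i * \<eta> h i * \<phi> i z)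
          + s\<^sup>2 * ((ell z)\<^sup>2 / S) * (\<Sum>i<n. c i * (\<eta> h i)\<^sup>2)"
        by (simp add: sum.distrib sum_distrib_left)
      also have "(\<Sum>i<n. c i * \<eta> h i * \<phi> i z) = \<nu> * ell z + \<epsilon> * \<psi> z" by (rule cross)
      also have "s\<^sup>2 * ((ell z)\<^sup>2 / S) * (\<Sum>i<n. c i * (\<eta> h i)\<^sup>2) \<le> s\<^sup>2 * ((ell z)\<^sup>2 / S) * (S * H)"
        using *(10)[of h] S by (intro mult_left_mono) (auto simp: H_def)
      also have "2 * (s * (1 - s)) * (ell z / S) * (\<nu> * ell z + \<epsilon> * \<psi> z)
          = 2 * (s * (1 - s)) * (\<nu> / S) * (ell z)\<^sup>2 + s * (1 - s) * (\<epsilon> / S) * (2 * ell z * \<psi> z)"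
        by (simp add: power2_eq_square divide_inverse algebra_simps)
      also have "s * (1 - s) * (\<epsilon> / S) * (2 * ell z * \<psi> z) \<le> s * (1 - s) * (\<epsilon> / S) * ((ell z)\<^sup>2 + (\<psi> z)\<^sup>2)"
        using ss \<epsilon>0(1) S sum_squares_bound[of "ell z" "\<psi> z"] by (intro mult_left_mono) auto
      finally have "(\<Sum>i<n. c i / S * (w i z)\<^sup>2) \<le> (\<Sum>i<n. (1 - s)\<^sup>2 * (c i / S) * (\<phi> i z)\<^sup>2)
          + (2 * (s * (1 - s)) * (\<nu> / S) * (ell z)\<^sup>2 + s * (1 - s) * (\<epsilon> / S) * ((ell z)\<^sup>2 + (\<psi> z)\<^sup>2))
          + s\<^sup>2 * ((ell z)\<^sup>2 / S) * (S * H)" by simp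
      also have "\<dots> = (\<Sum>j<Suc (Suc n). d j * (\<mu> j z)\<^sup>2)"
      proof -
        have d1: "(\<Sum>j<n. d j * (\<mu> j z)\<^sup>2) = (\<Sum>i<n. (1 - s)\<^sup>2 * (c i / S) * (\<phi> i z)\<^sup>2)"
          by (intro sum.cong) (auto simp: d_def \<mu>_def)
        have d2: "d n * (\<mu> n z)\<^sup>2
            = (2 * s * (1 - s) * (\<nu> / S) + s * (1 - s) * (\<epsilon> / S) + s\<^sup>2 * H) * (ell z)\<^sup>2"
          "d (Suc n) * (\<mu> (Suc n) z)\<^sup>2 = s * (1 - s) * (\<epsilon> / S) * (\<psi> z)\<^sup>2"
          by (simp_all add: d_def \<mu>_def)
        have d3: "s\<^sup>2 * ((ell z)\<^sup>2 / S) * (S * H) = s\<^sup>2 * H * (ell z)\<^sup>2" using S by simp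
        show ?thesis unfolding split d1 d2 d3 by (simp add: divide_inverse algebra_simps)
      qed
      finally show ?thesis .
    qed
    \<comment> \<open>The unperturbed part pairs the decomposition with \<open>t\<close> and gives
      \<nu>; in the perturbation the decomposition reproduces \<open>h\<close>, leaving
      \<open>ell h\<close>.\<close>
    have "(\<Sum>i<n. c i / S * w i (x i)) = (1 - s) / S * (\<Sum>i<n. c i * \<phi> i (x i))
        + s / S * (\<Sum>i<n. c i * \<eta> h i * ell (x i))"
    proof -
      have "c i / S * w i (x i) = (1 - s) / S * (c i * \<phi> i (x i)) + s / S * (c i * \<eta> h i * ell (x i))" for i
        by (simp add: w divide_inverse algebra_simps)
      then show ?thesis by (simp add: sum.distrib sum_distrib_left)
    qed
    also have "(\<Sum>i<n. c i * \<phi> i (x i)) = \<nu>" using *(9) by (simp add: \<phi>)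
    also have "(\<Sum>i<n. c i * \<eta> h i * ell (x i)) = ell (\<Sum>i<n. (c i * \<eta> h i) *\<^sub>R x i)"
      by (simp add: blinfun.sum_right blinfun.scaleR_right)
    also have "(\<Sum>i<n. (c i * \<eta> h i) *\<^sub>R x i) = h" by (rule *(5))
    finally have tr: "(\<Sum>i<n. c i / S * w i (x i)) = R S"
      by (simp add: ellh R_def divide_inverse algebra_simps)
    have "0 \<le> R S" unfolding R_def using s g \<nu> S by simp
    then show "sqrt (B S) < (\<Sum>i<n. c i / S * w i (x i))"
      unfolding tr using RB real_sqrt_less_mono[OF RB] by simp
  qed
qed

end

section \<open>Assembly: the perturbed operator in the cone inclusions\<close>

theorem corollary6p7:
  assumes finite_dim: "\<exists>B :: 'a::real_normed_vector set. finite B \<and> span B = UNIV"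
    and not_euclidean: "\<not> euclidean_norm (norm :: 'a \<Rightarrow> real)"
  shows "\<exists>(P :: 'a \<Rightarrow>\<^sub>L 'a) (\<alpha> :: real). \<alpha> \<ge> 0 \<and>
    \<not> entanglement_breaking norm_cone norm_cone (scal_oplus \<alpha> P) \<and>
    (\<forall>k\<ge>1. tens_map (scal_oplus \<alpha> P) ` hat_pow k \<subseteq> min_pow k norm_cone \<and>
           tens_map (scal_oplus \<alpha> P) ` max_pow k norm_cone \<subseteq> check_pow k)"
proof -
  obtain E and f :: "'a \<Rightarrow> 'a \<Rightarrow>\<^sub>L real" where E: "finite E" "\<And>v. (\<Sum>b\<in>E. f b v *\<^sub>R b) = v"
    using bounded_coordinates[OF finite_dim] by metis
  obtain \<nu> and t :: "'a \<Rightarrow> 'a \<Rightarrow>\<^sub>L real" where t: "\<And>x. (\<Sum>b\<in>E. (t b x)\<^sup>2) \<le> (norm x)\<^sup>2"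
    "norms_identity E f t \<nu>"
    by (rule nuclear_duality[OF E]) (rule that)
  obtain n m :: nat and c d :: "nat \<Rightarrow> real" and x :: "nat \<Rightarrow> 'a" and w \<mu> :: "nat \<Rightarrow> 'a \<Rightarrow>\<^sub>L real" and \<beta> :: real
    where *: "\<And>i. i < n \<Longrightarrow> 0 \<le> c i" "(\<Sum>i<n. c i) \<le> 1" "\<And>i. i < n \<Longrightarrow> norm (x i) \<le> 1"
    "\<And>j. j < m \<Longrightarrow> 0 \<le> d j" "(\<Sum>j<m. d j) \<le> \<beta>\<^sup>2" "0 \<le> \<beta>" "\<And>j. j < m \<Longrightarrow> norm (\<mu> j) \<le> 1"
    "\<And>v. (\<Sum>i<n. c i * (w i v)\<^sup>2) \<le> (\<Sum>j<m. d j * (\<mu> j v)\<^sup>2)"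
    "\<beta> < (\<Sum>i<n. c i * w i (x i))"
    by (rule exists_two_summing_large_trace[OF E t not_euclidean]) (rule that)
  define P where "P = (\<Sum>i<n. rank_one (c i *\<^sub>R w i) (x i))"
  have P: "P v = (\<Sum>i<n. (c i * w i v) *\<^sub>R x i)" for v
    by (simp add: P_def blinfun.sum_left blinfun.scaleR_left)
  have "inj_proj_bounded \<beta> P"
    by (rule two_summing_inj_proj_bounded[where A = "{..<n}" and J = "{..<m}" and c = c and w = w
          and x = x and d = d and \<mu> = \<mu>]) (use * P in auto)
  moreover have "norm (P v) \<le> \<beta> * norm v" for v
    by (rule two_summing_norm_le[where A = "{..<n}" and J = "{..<m}" and c = c and w = w
          and x = x and d = d and \<mu> = \<mu>]) (use * P in auto)
  moreover have "\<not> entanglement_breaking norm_cone norm_cone (scal_oplus \<beta> P)"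
    by (rule not_entanglement_breaking_if_trace[where A = "{..<n}" and w = "\<lambda>i. c i *\<^sub>R w i"
          and x = x and f = f and e = "\<lambda>b. b" and E = E])
       (use E * P in \<open>simp_all add: blinfun.scaleR_left\<close>)
  ultimately show ?thesis
    using tens_map_hat_pow_subset tens_map_max_pow_subset *(6) by blast
qed

end
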